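(* Let $X,Y$ be random variables with values in finite sets $\mathcal X,\mathcal Y$ and let $U^1$ be a binary random variable such that $U^1\to X\to Y$ is a Markov chain. Let $0<\beta_2<\beta<1/2$. For $N=2^n$ let $P_{\bar U^1\bar X\bar Y}$ be the law of $N$ i.i.d. copies of $(U^1,X,Y)$, let $\bar U_A^1,\bar U_B^1$ be the sequences formed by Terminals A and B in the first-round protocol described in the context (with $\delta_N=2^{-N^\beta}$), and let $Q_{\bar U_B^1\bar X\bar Y}$ be the law of $(\bar U_B^1,\bar X,\bar Y)$. Then, as $N\to\infty$, $$\big\|Q_{\bar U_B^1\bar X\bar Y}-P_{\bar U^1\bar X\bar Y}\big\|_1=O(2^{-N^{\beta_2}}),\qquad \Pr\{\bar U_A^1=\bar U_B^1\}=1-O(2^{-N^{\beta_2}}).$$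
   Context: Polarization notation. $N=2^n$, $n\in\mathbb N$; $[N]=\{1,\dots,N\}$; $\delta_N=2^{-N^\beta}$. A bar denotes an $N$-vector, $w^{1:k}=(w^1,\dots,w^k)$. $G_N=B_NF^{\otimes n}$ over $\mathbb F_2$, where $F=\begin{pmatrix}1&0\\1&1\end{pmatrix}$, $\otimes$ is the Kronecker product and $B_N$ is the $N\times N$ bit-reversal permutation matrix. For a binary random variable $T$ and a discrete random variable $V$, $Z(T|V)=2\sum_{v}P_V(v)\sqrt{P_{T|V}(0|v)P_{T|V}(1|v)}$. Let $(\bar X,\bar Y,\bar U^1)$ be $N$ i.i.d. copies of $(X,Y,U^1)$ and $\bar V^1=\bar U^1G_N$; $P$ denotes the joint law of $(\bar X,\bar Y,\bar U^1,\bar V^1)$ and all its marginals and conditionals (conditional laws given zero-probability events are fixed arbitrarily). Put $\mathcal L_{U^1}=\{i\in[N]:Z((V^1)^i|(V^1)^{1:i-1})\le\delta_N\}$, $\mathcal L_{U^1|Y}=\{i\in[N]:Z((V^1)^i|(V^1)^{1:i-1},\bar Y)\le\delta_N\}$, $\mathcal H_{U^1|X}=\{i\in[N]:Z((V^1)^i|(V^1)^{1:i-1},\bar X)\ge1-\delta_N\}$, and (complements in $[N]$) $\mathcal F_r=\mathcal L^c_{U^1}\cap\mathcal H_{U^1|X}$, $\mathcal F_d=\mathcal L_{U^1}$, $\mathcal I=\mathcal L^c_{U^1}\cap\mathcal H^c_{U^1|X}$, $\mathcal I'=\mathcal I\setminus(\mathcal L^c_{U^1}\cap\mathcal L_{U^1|Y})$.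 First-round protocol. $(\bar X,\bar Y)$ is distributed as $N$ i.i.d. copies of $(X,Y)$; A observes $\bar X$, B observes $\bar Y$. Given $\bar X=\bar x$, Terminal A generates $\bar v_A^1$ successively for $i=1,\dots,N$: $(v_A^1)^i$ is a uniform bit if $i\in\mathcal F_r$; it is sampled from $P_{(V^1)^i|(V^1)^{1:i-1}}(\cdot|(v_A^1)^{1:i-1})$ if $i\in\mathcal F_d$; and from $P_{(V^1)^i|(V^1)^{1:i-1}\bar X}(\cdot|(v_A^1)^{1:i-1},\bar x)$ if $i\in\mathcal I$. A sends the bits $(v_A^1)^i$, $i\in\mathcal I'$, to B. Terminal B, given $\bar Y=\bar y$, forms $\bar v_B^1$ successively for $i=1,\dots,N$: $(v_B^1)^i=(v_A^1)^i$ if $i\in\mathcal I'$; if $i\in\mathcal F_r$ it uses the same uniform bit as A (shared randomness); if $i\in\mathcal F_d$ it samples from $P_{(V^1)^i|(V^1)^{1:i-1}}(\cdot|(v_B^1)^{1:i-1})$; if $i\in\mathcal I\setminus\mathcal I'$ it samples from $P_{(V^1)^i|(V^1)^{1:i-1}\bar Y}(\cdot|(v_B^1)^{1:i-1},\bar y)$. The private samplings of A and B use independent randomness; shared bits are independent of everything else. Finally $\bar U_A^1=\bar V_A^1G_N$, $\bar U_B^1=\bar V_B^1G_N$. $\|\cdot\|_1$ is the $\ell_1$ distance between probability mass functions. The constants in $O(\cdot)$ do not depend on $N$. *)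

theory Defs
  imports
    "HOL-Probability.Probability"
    "HOL-Library.Landau_Symbols"
    "HOL-Library.Z2"
    "Jordan_Normal_Form.Matrix"
begin

text \<open>
  Vectors of length \<open>N = 2 ^ n\<close> are lists, and the coordinates \<open>1, \<dots>, N\<close> are numbered
  \<open>0, \<dots>, N - 1\<close>.  The entry written \<open>w\<^sup>i\<close> with 1-based \<open>i\<close> is thus \<open>w ! (i - 1)\<close>, and its past
  \<open>w\<^sup>1\<^sup>:\<^sup>i\<^sup>-\<^sup>1\<close> is \<open>take (i - 1) w\<close>; with 0-based \<open>i\<close> these are \<open>w ! i\<close> and \<open>take i w\<close>.
\<close>


section \<open>The polar transform over the field with two elements\<close>

definition kron_mat :: "'a::semiring_1 mat \<Rightarrow> 'a mat \<Rightarrow> 'a mat" where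
  "kron_mat A B = mat (dim_row A * dim_row B) (dim_col A * dim_col B)
     (\<lambda>(i, j). A $$ (i div dim_row B, j div dim_col B) * B $$ (i mod dim_row B, j mod dim_col B))"

primrec kron_power :: "'a::semiring_1 mat \<Rightarrow> nat \<Rightarrow> 'a mat" where
  "kron_power A 0 = 1\<^sub>m 1"
| "kron_power A (Suc n) = kron_mat A (kron_power A n)"

definition kernel_mat :: "bit mat" where
  "kernel_mat = mat_of_rows_list 2 [[1, 0], [1, 1]]"

definition bit_reversal :: "nat \<Rightarrow> nat \<Rightarrow> nat" where
  "bit_reversal n i = (\<Sum>k<n. (i div 2 ^ k mod 2) * 2 ^ (n - 1 - k))"

definition bit_reversal_mat :: "nat \<Rightarrow> bit mat" where
  "bit_reversal_mat n = mat (2 ^ n) (2 ^ n) (\<lambda>(i, j). if j = bit_reversal n i then 1 else 0)"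

definition polar_mat :: "nat \<Rightarrow> bit mat" where
  "polar_mat n = bit_reversal_mat n * kron_power kernel_mat n"

text \<open>The row vector \<open>w G\<close> is computed as the column vector \<open>G\<^sup>T w\<^sup>T\<close>.\<close>

definition polar_transform :: "nat \<Rightarrow> bit list \<Rightarrow> bit list" where
  "polar_transform n w = list_of_vec (transpose_mat (polar_mat n) *\<^sub>v vec_of_list w)"


section \<open>Conditional laws, Bhattacharyya parameter, Markov chains, distance\<close>

text \<open>
  The conditional law of \<open>T\<close> given \<open>V = v\<close>.  The value at a \<open>v\<close> of probability zero is \<open>d v\<close>,
  where \<open>d\<close> is an arbitrary parameter.
\<close>

definition cond_law ::
    "('v \<Rightarrow> 't pmf) \<Rightarrow> 'a pmf \<Rightarrow> ('a \<Rightarrow> 't) \<Rightarrow> ('a \<Rightarrow> 'v) \<Rightarrow> 'v \<Rightarrow> 't pmf" where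
  "cond_law d M T V v =
     (if v \<in> set_pmf (map_pmf V M) then map_pmf T (cond_pmf M {w. V w = v}) else d v)"

text \<open>Only values \<open>v\<close> of positive probability enter the sum, so no default is needed.\<close>

definition bhattacharyya :: "'a pmf \<Rightarrow> ('a \<Rightarrow> bit) \<Rightarrow> ('a \<Rightarrow> 'v) \<Rightarrow> real" where
  "bhattacharyya M T V =
     2 * (\<Sum>\<^sub>\<infinity>v\<in>set_pmf (map_pmf V M). pmf (map_pmf V M) v *
            sqrt (pmf (map_pmf T (cond_pmf M {w. V w = v})) 0 *
                  pmf (map_pmf T (cond_pmf M {w. V w = v})) 1))"

text \<open>\<open>A \<rightarrow> B \<rightarrow> C\<close> is a Markov chain.\<close>

definition markov_chain :: "'w pmf \<Rightarrow> ('w \<Rightarrow> 'a) \<Rightarrow> ('w \<Rightarrow> 'b) \<Rightarrow> ('w \<Rightarrow> 'c) \<Rightarrow> bool" where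
  "markov_chain M A B C \<longleftrightarrow>
     (\<forall>a b c. \<P>(w in M. A w = a \<and> B w = b) > 0 \<longrightarrow>
        \<P>(w in M. C w = c \<bar> A w = a \<and> B w = b) = \<P>(w in M. C w = c \<bar> B w = b))"

definition l1_dist :: "'a pmf \<Rightarrow> 'a pmf \<Rightarrow> real" where
  "l1_dist p q = (\<Sum>\<^sub>\<infinity>z. \<bar>pmf p z - pmf q z\<bar>)"


section \<open>The source and its polarization\<close>

text \<open>
  \<open>P\<close> is the law of a triple \<open>(U, X, Y)\<close>; \<open>source_law P n\<close> is the law of the triple of sequences
  formed by \<open>2 ^ n\<close> independent copies.
\<close>

definition source_law ::
    "(bit \<times> 'x \<times> 'y) pmf \<Rightarrow> nat \<Rightarrow> (bit list \<times> 'x list \<times> 'y list) pmf" where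
  "source_law P n =
     map_pmf (\<lambda>w. (map fst w, map (fst \<circ> snd) w, map (snd \<circ> snd) w)) (replicate_pmf (2 ^ n) P)"

definition polar_law ::
    "(bit \<times> 'x \<times> 'y) pmf \<Rightarrow> nat \<Rightarrow> ('x list \<times> 'y list \<times> bit list \<times> bit list) pmf" where
  "polar_law P n = map_pmf (\<lambda>(us, xs, ys). (xs, ys, us, polar_transform n us)) (source_law P n)"

definition coord :: "nat \<Rightarrow> 'x list \<times> 'y list \<times> bit list \<times> bit list \<Rightarrow> bit" where
  "coord i = (\<lambda>(xs, ys, us, vs). vs ! i)"

definition past :: "nat \<Rightarrow> 'x list \<times> 'y list \<times> bit list \<times> bit list \<Rightarrow> bit list" where
  "past i = (\<lambda>(xs, ys, us, vs). take i vs)"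

definition past_X :: "nat \<Rightarrow> 'x list \<times> 'y list \<times> bit list \<times> bit list \<Rightarrow> bit list \<times> 'x list" where
  "past_X i = (\<lambda>(xs, ys, us, vs). (take i vs, xs))"

definition past_Y :: "nat \<Rightarrow> 'x list \<times> 'y list \<times> bit list \<times> bit list \<Rightarrow> bit list \<times> 'y list" where
  "past_Y i = (\<lambda>(xs, ys, us, vs). (take i vs, ys))"

definition delta :: "real \<Rightarrow> nat \<Rightarrow> real" where
  "delta \<beta> n = 2 powr (- (real (2 ^ n) powr \<beta>))"

definition low_U :: "(bit \<times> 'x \<times> 'y) pmf \<Rightarrow> real \<Rightarrow> nat \<Rightarrow> nat set" where
  "low_U P \<beta> n =
     {i \<in> {..<2 ^ n}. bhattacharyya (polar_law P n) (coord i) (past i) \<le> delta \<beta> n}"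

definition low_UY :: "(bit \<times> 'x \<times> 'y) pmf \<Rightarrow> real \<Rightarrow> nat \<Rightarrow> nat set" where
  "low_UY P \<beta> n =
     {i \<in> {..<2 ^ n}. bhattacharyya (polar_law P n) (coord i) (past_Y i) \<le> delta \<beta> n}"

definition high_UX :: "(bit \<times> 'x \<times> 'y) pmf \<Rightarrow> real \<Rightarrow> nat \<Rightarrow> nat set" where
  "high_UX P \<beta> n =
     {i \<in> {..<2 ^ n}. bhattacharyya (polar_law P n) (coord i) (past_X i) \<ge> 1 - delta \<beta> n}"

definition F_r :: "(bit \<times> 'x \<times> 'y) pmf \<Rightarrow> real \<Rightarrow> nat \<Rightarrow> nat set" where
  "F_r P \<beta> n = ({..<2 ^ n} - low_U P \<beta> n) \<inter> high_UX P \<beta> n"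

definition F_d :: "(bit \<times> 'x \<times> 'y) pmf \<Rightarrow> real \<Rightarrow> nat \<Rightarrow> nat set" where
  "F_d P \<beta> n = low_U P \<beta> n"

definition I_set :: "(bit \<times> 'x \<times> 'y) pmf \<Rightarrow> real \<Rightarrow> nat \<Rightarrow> nat set" where
  "I_set P \<beta> n = ({..<2 ^ n} - low_U P \<beta> n) \<inter> ({..<2 ^ n} - high_UX P \<beta> n)"

definition I_sent :: "(bit \<times> 'x \<times> 'y) pmf \<Rightarrow> real \<Rightarrow> nat \<Rightarrow> nat set" where
  "I_sent P \<beta> n = I_set P \<beta> n - (({..<2 ^ n} - low_U P \<beta> n) \<inter> low_UY P \<beta> n)"


section \<open>The first-round protocol\<close>

text \<open>
  Generate a list of length \<open>m\<close> from left to right; \<open>K i v\<close> is the law of the entry at position \<open>i\<close>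
  when the entries before it are \<open>v\<close>.
\<close>

primrec sequential_pmf :: "(nat \<Rightarrow> 'a list \<Rightarrow> 'a pmf) \<Rightarrow> nat \<Rightarrow> 'a list pmf" where
  "sequential_pmf K 0 = return_pmf []"
| "sequential_pmf K (Suc m) =
     do {v \<leftarrow> sequential_pmf K m; b \<leftarrow> K m v; return_pmf (v @ [b])}"

text \<open>
  In the next two definitions, the list \<open>rs\<close> holds the shared uniform bits; only its entries at
  positions in \<open>F_r\<close> are read.  The sets \<open>F_r\<close>, \<open>F_d\<close> and \<open>I_set\<close> partition the coordinates, and
  \<open>I_sent\<close> is a subset of \<open>I_set\<close>, so the last branch covers \<open>I_set\<close> for Terminal A and
  \<open>I_set - I_sent\<close> for Terminal B.  The families \<open>dU\<close>, \<open>dX\<close>, \<open>dY\<close> (indexed by \<open>n\<close> and by the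
  coordinate) are the values of the conditional laws given events of probability zero.
\<close>

definition step_A ::
    "(nat \<Rightarrow> nat \<Rightarrow> bit list \<Rightarrow> bit pmf) \<Rightarrow> (nat \<Rightarrow> nat \<Rightarrow> bit list \<times> 'x list \<Rightarrow> bit pmf) \<Rightarrow>
     (bit \<times> 'x \<times> 'y) pmf \<Rightarrow> real \<Rightarrow> nat \<Rightarrow> bit list \<Rightarrow> 'x list \<Rightarrow> nat \<Rightarrow> bit list \<Rightarrow> bit pmf" where
  "step_A dU dX P \<beta> n rs xs i v =
     (if i \<in> F_r P \<beta> n then return_pmf (rs ! i)
      else if i \<in> F_d P \<beta> n then cond_law (dU n i) (polar_law P n) (coord i) (past i) v
      else cond_law (dX n i) (polar_law P n) (coord i) (past_X i) (v, xs))"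

definition step_B ::
    "(nat \<Rightarrow> nat \<Rightarrow> bit list \<Rightarrow> bit pmf) \<Rightarrow> (nat \<Rightarrow> nat \<Rightarrow> bit list \<times> 'y list \<Rightarrow> bit pmf) \<Rightarrow>
     (bit \<times> 'x \<times> 'y) pmf \<Rightarrow> real \<Rightarrow> nat \<Rightarrow> bit list \<Rightarrow> bit list \<Rightarrow> 'y list \<Rightarrow> nat \<Rightarrow> bit list \<Rightarrow> bit pmf"
  where
  "step_B dU dY P \<beta> n rs vA ys i v =
     (if i \<in> I_sent P \<beta> n then return_pmf (vA ! i)
      else if i \<in> F_r P \<beta> n then return_pmf (rs ! i)
      else if i \<in> F_d P \<beta> n then cond_law (dU n i) (polar_law P n) (coord i) (past i) v
      else cond_law (dY n i) (polar_law P n) (coord i) (past_Y i) (v, ys))"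

text \<open>The joint law of the two final sequences of A and B and of the two observations.\<close>

definition protocol_law ::
    "(nat \<Rightarrow> nat \<Rightarrow> bit list \<Rightarrow> bit pmf) \<Rightarrow> (nat \<Rightarrow> nat \<Rightarrow> bit list \<times> 'x list \<Rightarrow> bit pmf) \<Rightarrow>
     (nat \<Rightarrow> nat \<Rightarrow> bit list \<times> 'y list \<Rightarrow> bit pmf) \<Rightarrow>
     (bit \<times> 'x \<times> 'y) pmf \<Rightarrow> real \<Rightarrow> nat \<Rightarrow> (bit list \<times> bit list \<times> 'x list \<times> 'y list) pmf" where
  "protocol_law dU dX dY P \<beta> n =
     do {
       xys \<leftarrow> replicate_pmf (2 ^ n) (map_pmf snd P);
       let xs = map fst xys; let ys = map snd xys;
       rs \<leftarrow> replicate_pmf (2 ^ n) (pmf_of_set {0, 1});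
       vA \<leftarrow> sequential_pmf (step_A dU dX P \<beta> n rs xs) (2 ^ n);
       vB \<leftarrow> sequential_pmf (step_B dU dY P \<beta> n rs vA ys) (2 ^ n);
       return_pmf (polar_transform n vA, polar_transform n vB, xs, ys)
     }"

end

theory Submission
  imports Defs "HOL-Real_Asymp.Real_Asymp"
begin

text \<open>
  No polarization theorem is needed.  By the chain rule, and since \<open>U \<rightarrow> X \<rightarrow> Y\<close> is a Markov chain,
  drawing every coordinate from its conditional law given the past and \<open>X\<close> reproduces the law of the
  source exactly.  Terminal A departs from this ideal sampler only on \<open>F_r\<close> and \<open>F_d\<close>, where the
  expected \<open>l\<^sub>1\<close> error of one step is at most \<open>2 sqrt \<delta>\<close>, so by telescoping the whole sequence is
  \<open>2 N sqrt \<delta>\<close>-close to ideal.  On an ideal sequence Terminal B, coordinate by coordinate, misses A's bit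
  with probability at most the corresponding Bhattacharyya parameter, hence at most \<open>\<delta>\<close>; replacing the
  ideal law of A's sequence by the actual one costs another \<open>2 N sqrt \<delta>\<close>.  Finally
  \<open>N sqrt \<delta> = O (2 ^ (- N ^ \<beta>\<^sub>2))\<close> since \<open>\<beta>\<^sub>2 < \<beta>\<close>.
\<close>

section \<open>The polar transform is an involution\<close>

text \<open>The Bhattacharyya bounds are averages under the law of the source, whereas the terminals
  run under laws of their own, so every comparison has to leave the average on the source side. For
  A this decides which of the two laws carries the step errors in the telescoping. B is harder,
  since its kernel also reads A's sequence and the shared bits. But given that A produced
  \<open>v\<close>, the probability that B repeats all of \<open>v\<close> is a product of factors
  taken along \<open>v\<close>, hence a test with values in [0,1] of A's sequence and
  \<open>ys\<close>. Such a test can be moved from A's law to the ideal one at the price of an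
  \<open>l1\<close> distance, so no second sampler has to be telescoped.

  The same arrangement takes care of the arbitrary conditional laws at null events: the actual
  protocol can run into them, but the step errors are averaged over histories of the source, which
  all have positive probability.

  The estimates concern the polarized sequences \<open>v\<close>; since the transform is its own
  inverse, one and the same map carries both the protocol's \<open>v\<close> and the source's
  \<open>v\<close> to the sequences \<open>u\<close>.\<close>

lemma index_mult_mat_sum:
  assumes "A \<in> carrier_mat a b" "B \<in> carrier_mat b c" "i < a" "j < c"
  shows "(A * B) $$ (i, j) = (\<Sum>k<b. A $$ (i, k) * B $$ (k, j))"
  using assms by (simp add: scalar_prod_def atLeast0LessThan)

lemma kernel_mat_carrier: "kernel_mat \<in> carrier_mat 2 2"
  unfolding kernel_mat_def mat_of_rows_list_def by (rule carrier_matI) simp_all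

lemma kernel_mat_entry:
  assumes "a < 2" "b < 2"
  shows "kernel_mat $$ (a, b) = (if b \<le> a then 1 else 0)"
proof -
  have "(a = 0 \<or> a = 1) \<and> (b = 0 \<or> b = 1)" using assms by linarith
  then show ?thesis by (elim conjE disjE) (simp_all add: kernel_mat_def mat_of_rows_list_def)
qed

lemma kron_power_carrier:
  assumes "A \<in> carrier_mat r c"
  shows "kron_power A n \<in> carrier_mat (r ^ n) (c ^ n)"
  using assms by (induction n) (auto simp: kron_mat_def)

text \<open>An entry factors over the base-\<open>b\<close> digits of its two indices, so applying
  the same permutation of digits to both indices only reorders a product. This form is what makes
  bit reversal tractable.\<close>

lemma kron_power_entry:
  fixes A :: "'a::comm_semiring_1 mat"
  assumes "A \<in> carrier_mat b b" "i < b ^ n" "j < b ^ n"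
  shows "kron_power A n $$ (i, j) = (\<Prod>k<n. A $$ (i div b ^ k mod b, j div b ^ k mod b))"
  using assms(2,3)
proof (induction n arbitrary: i j)
  case 0
  then show ?case by simp
next
  case (Suc n)
  have b: "b > 0" using Suc.prems by (cases b) auto
  note c = kron_power_carrier[OF assms(1), of n]
  have digit: "m mod b ^ n div b ^ k mod b = m div b ^ k mod b" if "k < n" for m k :: nat
  proof -
    have "b ^ n = b ^ k * (b * b ^ (n - Suc k))"
      using that by (metis add_diff_inverse_nat less_Suc_eq_le not_less_eq power_Suc power_add
          add_Suc_right add_Suc)
    then have "m mod b ^ n div b ^ k = m div b ^ k mod (b * b ^ (n - Suc k))"
      using b by (simp add: mod_mult2_eq)
    then show ?thesis by (simp add: mod_mod_cancel)
  qed
  have top: "m div b ^ n mod b = m div b ^ n" if "m < b ^ Suc n" for m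
    using that by (simp add: less_mult_imp_div_less mult.commute)
  have "kron_power A (Suc n) $$ (i, j) =
      A $$ (i div b ^ n, j div b ^ n) * kron_power A n $$ (i mod b ^ n, j mod b ^ n)"
    using c assms(1) Suc.prems unfolding kron_power.simps kron_mat_def
    by (subst index_mat) (simp_all only: carrier_matD power_Suc case_prod_conv)
  also have "kron_power A n $$ (i mod b ^ n, j mod b ^ n) =
      (\<Prod>k<n. A $$ (i div b ^ k mod b, j div b ^ k mod b))"
  proof (subst Suc.IH)
    show "i mod b ^ n < b ^ n" "j mod b ^ n < b ^ n" using b by simp_all
  qed (intro prod.cong refl, simp only: lessThan_iff digit)
  finally show ?case
    by (simp only: prod.lessThan_Suc top[OF Suc.prems(1)] top[OF Suc.prems(2)] mult.commute)
qed

text \<open>The mixed-product rule of the Kronecker product, in the one instance where both factors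
  square to the identity.\<close>

lemma kron_power_square:
  fixes A :: "'a::comm_semiring_1 mat"
  assumes A: "A \<in> carrier_mat b b" and AA: "A * A = 1\<^sub>m b"
  shows "kron_power A n * kron_power A n = 1\<^sub>m (b ^ n)"
proof (induction n)
  case 0
  then show ?case by simp
next
  case (Suc n)
  let ?K = "kron_power A n"
  have c: "?K \<in> carrier_mat (b ^ n) (b ^ n)" by (rule kron_power_carrier[OF A])
  have c': "kron_mat A ?K \<in> carrier_mat (b * b ^ n) (b * b ^ n)"
    using A c by (auto simp: kron_mat_def)
  have e: "kron_mat A ?K $$ (i, j) = A $$ (i div b ^ n, j div b ^ n) * ?K $$ (i mod b ^ n, j mod b ^ n)"
    if "i < b * b ^ n" "j < b * b ^ n" for i j
    using A c that by (auto simp: kron_mat_def)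
  have "kron_mat A ?K * kron_mat A ?K = 1\<^sub>m (b * b ^ n)"
  proof (rule eq_matI)
    fix i j assume ij: "i < dim_row (1\<^sub>m (b * b ^ n) :: 'a mat)" "j < dim_col (1\<^sub>m (b * b ^ n) :: 'a mat)"
    let ?N = "b ^ n"
    have N: "?N > 0" "b > 0" using ij by (auto intro!: Nat.gr0I)
    have lt: "i div ?N < b" "i mod ?N < ?N" "j div ?N < b" "j mod ?N < ?N"
      using ij N by (auto simp: less_mult_imp_div_less)
    have sumA: "(\<Sum>k<b. A $$ (p, k) * A $$ (k, q)) = (if p = q then 1 else 0)" if "p < b" "q < b" for p q
      using index_mult_mat_sum[OF A A that] that by (simp add: AA)
    have sumK: "(\<Sum>k<?N. ?K $$ (p, k) * ?K $$ (k, q)) = (if p = q then 1 else 0)" if "p < ?N" "q < ?N" for p q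
      using index_mult_mat_sum[OF c c that] that by (simp add: Suc.IH)
    have bound: "p * ?N + q < b * ?N" if "p < b" "q < ?N" for p q
    proof -
      have "p * ?N + q < Suc p * ?N" using that by simp
      also have "\<dots> \<le> b * ?N" using that by (intro mult_right_mono) auto
      finally show ?thesis .
    qed
    have "(kron_mat A ?K * kron_mat A ?K) $$ (i, j) =
        (\<Sum>m<b * ?N. kron_mat A ?K $$ (i, m) * kron_mat A ?K $$ (m, j))"
      using index_mult_mat_sum[OF c' c'] ij by simp
    also have "\<dots> = (\<Sum>m<b * ?N. A $$ (i div ?N, m div ?N) * ?K $$ (i mod ?N, m mod ?N) *
        (A $$ (m div ?N, j div ?N) * ?K $$ (m mod ?N, j mod ?N)))"
      using ij by (intro sum.cong) (auto simp: e)
    \<comment> \<open>The summation index is split as \<open>m = p * b ^ n + q\<close>; afterwards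
      the double sum separates into a product of two matrix entries.\<close>
    also have "\<dots> = (\<Sum>(p, q)\<in>{..<b} \<times> {..<?N}. A $$ (i div ?N, p) * ?K $$ (i mod ?N, q) *
        (A $$ (p, j div ?N) * ?K $$ (q, j mod ?N)))"
      using N by (intro sum.reindex_bij_witness[where i = "\<lambda>(p, q). p * ?N + q" and j = "\<lambda>m. (m div ?N, m mod ?N)"])
        (auto simp: less_mult_imp_div_less bound div_mult_mod_eq)
    also have "\<dots> = (\<Sum>(p, q)\<in>{..<b} \<times> {..<?N}. (A $$ (i div ?N, p) * A $$ (p, j div ?N)) *
        (?K $$ (i mod ?N, q) * ?K $$ (q, j mod ?N)))"
      by (intro sum.cong) (auto simp: mult_ac)
    also have "\<dots> = (\<Sum>p<b. A $$ (i div ?N, p) * A $$ (p, j div ?N)) *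
        (\<Sum>q<?N. ?K $$ (i mod ?N, q) * ?K $$ (q, j mod ?N))"
      by (simp add: sum_product sum.cartesian_product)
    also have "\<dots> = (if i div ?N = j div ?N \<and> i mod ?N = j mod ?N then 1 else 0)"
      using lt by (simp add: sumA sumK)
    also have "\<dots> = 1\<^sub>m (b * ?N) $$ (i, j)"
      using ij by (auto) (metis div_mult_mod_eq)
    finally show "(kron_mat A ?K * kron_mat A ?K) $$ (i, j) = 1\<^sub>m (b * ?N) $$ (i, j)" .
  qed (use c' in auto)
  then show ?case by simp
qed

text \<open>Entry (1, 0) of the product is 1 + 1, which vanishes because the characteristic is
  two.\<close>

lemma kernel_mat_square: "kernel_mat * kernel_mat = 1\<^sub>m 2"
proof (rule eq_matI)
  fix i j assume "i < dim_row (1\<^sub>m 2 :: bit mat)" "j < dim_col (1\<^sub>m 2 :: bit mat)"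
  then have ij: "i < 2" "j < 2" by auto
  have "(kernel_mat * kernel_mat) $$ (i, j) = (\<Sum>k<2. kernel_mat $$ (i, k) * kernel_mat $$ (k, j))"
    by (rule index_mult_mat_sum[OF kernel_mat_carrier kernel_mat_carrier ij])
  also have "\<dots> = kernel_mat $$ (i, 0) * kernel_mat $$ (0, j) + kernel_mat $$ (i, 1) * kernel_mat $$ (1, j)"
  proof -
    have two: "{..<2 :: nat} = {0, 1}" by auto
    show ?thesis unfolding two by (subst sum.insert, simp, simp, subst sum.insert, simp, simp, subst sum.empty, rule arg_cong[OF add_0_right])
  qed
  also have "\<dots> = 1\<^sub>m 2 $$ (i, j)"
    using ij by (auto simp: kernel_mat_entry less_2_cases_iff)
  finally show "(kernel_mat * kernel_mat) $$ (i, j) = 1\<^sub>m 2 $$ (i, j)" .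
qed (use kernel_mat_carrier in auto)

section \<open>Bit reversal and the polar matrix\<close>

lemma binary_sum_less:
  fixes d :: "nat \<Rightarrow> nat"
  assumes "\<And>j. d j < 2"
  shows "(\<Sum>j<n. d j * 2 ^ j) < 2 ^ n"
proof (induction n)
  case (Suc n)
  have "d n * 2 ^ n \<le> 2 ^ n"
    using mult_le_mono1[of "d n" 1 "2 ^ n"] assms[of n] by linarith
  with Suc.IH have "(\<Sum>j<n. d j * 2 ^ j) + d n * 2 ^ n < 2 ^ n + 2 ^ n"
    by (rule add_less_le_mono)
  then show ?case by (simp add: mult_2)
qed simp

lemma binary_sum_digit:
  fixes d :: "nat \<Rightarrow> nat"
  assumes "\<And>j. d j < 2" "k < n"
  shows "(\<Sum>j<n. d j * 2 ^ j) div 2 ^ k mod 2 = d k"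
  using assms
proof (induction n arbitrary: d k)
  case (Suc n)
  have decomp: "(\<Sum>j<Suc n. d j * 2 ^ j) = d 0 + 2 * (\<Sum>j<n. d (Suc j) * 2 ^ j)"
    by (simp add: sum.lessThan_Suc_shift sum_distrib_left mult_ac del: sum.lessThan_Suc)
  show ?case
  proof (cases k)
    case 0
    then show ?thesis using Suc.prems(1)[of 0] by (simp add: decomp del: sum.lessThan_Suc)
  next
    case (Suc l)
    have "(\<Sum>j<Suc n. d j * 2 ^ j) div 2 ^ k = (\<Sum>j<n. d (Suc j) * 2 ^ j) div 2 ^ l"
      using Suc.prems(1)[of 0] Suc by (simp add: decomp div_mult2_eq del: sum.lessThan_Suc)
    then show ?thesis using Suc.IH[of "\<lambda>j. d (Suc j)" l] Suc.prems Suc by simp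
  qed
qed simp

text \<open>Reordered by increasing powers of two, the sum is an ordinary binary expansion, from
  which the digits can be read off.\<close>

lemma bit_reversal_alt:
  "bit_reversal n i = (\<Sum>j<n. (i div 2 ^ (n - 1 - j) mod 2) * 2 ^ j)"
proof -
  have "(\<Sum>k<n. (i div 2 ^ k mod 2) * 2 ^ (n - 1 - k)) =
      (\<Sum>j<n. (i div 2 ^ (n - 1 - j) mod 2) * 2 ^ (n - 1 - (n - 1 - j)))"
    by (rule sum.reindex_bij_witness[where i = "\<lambda>j. n - 1 - j" and j = "\<lambda>j. n - 1 - j"]) simp_all
  also have "\<dots> = (\<Sum>j<n. (i div 2 ^ (n - 1 - j) mod 2) * 2 ^ j)"
    by (intro sum.cong refl) simp
  finally show ?thesis unfolding bit_reversal_def .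
qed

lemma bit_reversal_less: "bit_reversal n i < 2 ^ n"
  unfolding bit_reversal_alt by (rule binary_sum_less) simp

lemma bit_reversal_digit:
  "k < n \<Longrightarrow> bit_reversal n i div 2 ^ k mod 2 = i div 2 ^ (n - 1 - k) mod 2"
  unfolding bit_reversal_alt by (rule binary_sum_digit) simp_all

lemma bit_reversal_involutive:
  assumes "i < 2 ^ n"
  shows "bit_reversal n (bit_reversal n i) = i"
proof -
  have binary: "(\<Sum>j<n. (m div 2 ^ j mod 2) * 2 ^ j) = m mod 2 ^ n" for m n :: nat
    by (induction n) (simp_all add: mod_mult2_eq mult.commute[of 2])
  have "bit_reversal n (bit_reversal n i) =
      (\<Sum>j<n. (bit_reversal n i div 2 ^ (n - 1 - j) mod 2) * 2 ^ j)"
    by (rule bit_reversal_alt)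
  also have "\<dots> = (\<Sum>j<n. (i div 2 ^ j mod 2) * 2 ^ j)"
    by (intro sum.cong refl) (simp add: bit_reversal_digit del: One_nat_def)
  finally show ?thesis using assms by (simp add: binary)
qed

text \<open>The permutation matrix of bit reversal commutes with the Kronecker power: reversal of
  both indices permutes the digit factors of an entry, and the product is commutative.\<close>

lemma kernel_power_bit_reversal:
  assumes "i < 2 ^ n" "j < 2 ^ n"
  shows "kron_power kernel_mat n $$ (bit_reversal n i, bit_reversal n j) = kron_power kernel_mat n $$ (i, j)"
proof -
  have "kron_power kernel_mat n $$ (bit_reversal n i, bit_reversal n j) =
      (\<Prod>k<n. kernel_mat $$ (bit_reversal n i div 2 ^ k mod 2, bit_reversal n j div 2 ^ k mod 2))"
    by (rule kron_power_entry[OF kernel_mat_carrier]) (rule bit_reversal_less)+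
  also have "\<dots> = (\<Prod>k<n. kernel_mat $$ (i div 2 ^ (n - 1 - k) mod 2, j div 2 ^ (n - 1 - k) mod 2))"
    by (rule prod.cong[OF refl]) (simp only: bit_reversal_digit lessThan_iff)
  also have "\<dots> = (\<Prod>k<n. kernel_mat $$ (i div 2 ^ k mod 2, j div 2 ^ k mod 2))"
    by (rule prod.reindex_bij_witness[where i = "\<lambda>j. n - 1 - j" and j = "\<lambda>j. n - 1 - j"]) auto
  also have "\<dots> = kron_power kernel_mat n $$ (i, j)"
    by (rule kron_power_entry[OF kernel_mat_carrier assms, symmetric])
  finally show ?thesis .
qed

lemma polar_mat_carrier: "polar_mat n \<in> carrier_mat (2 ^ n) (2 ^ n)"
  unfolding polar_mat_def bit_reversal_mat_def
  by (intro mult_carrier_mat[OF mat_carrier] kron_power_carrier kernel_mat_carrier)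

lemma polar_mat_entry:
  assumes "i < 2 ^ n" "j < 2 ^ n"
  shows "polar_mat n $$ (i, j) = kron_power kernel_mat n $$ (bit_reversal n i, j)"
proof -
  have r: "bit_reversal_mat n \<in> carrier_mat (2 ^ n) (2 ^ n)"
    by (simp add: bit_reversal_mat_def)
  have "polar_mat n $$ (i, j) =
      (\<Sum>k<2 ^ n. (if k = bit_reversal n i then 1 else 0) * kron_power kernel_mat n $$ (k, j))"
    unfolding polar_mat_def
      index_mult_mat_sum[OF r kron_power_carrier[OF kernel_mat_carrier] assms]
    using assms by (intro sum.cong refl) (simp only: bit_reversal_mat_def index_mat case_prod_conv lessThan_iff)
  also have "\<dots> = (\<Sum>k<2 ^ n. if k = bit_reversal n i then kron_power kernel_mat n $$ (k, j) else 0)"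
    by (intro sum.cong refl) (simp only: if_distrib[of "\<lambda>x. x * _"] mult_1_left mult_zero_left)
  also have "\<dots> = kron_power kernel_mat n $$ (bit_reversal n i, j)"
    by (subst sum.delta) (simp_all only: finite_lessThan lessThan_iff bit_reversal_less if_True)
  finally show ?thesis .
qed

text \<open>With \<open>B\<close> the reversal and \<open>K\<close> the Kronecker power,
  \<open>B K B K = B B K K = 1\<close>. In terms of entries, the reversal of the inner index
  \<open>k\<close> is moved onto \<open>j\<close>, which leaves an entry of \<open>K * K\<close> at
  two reversed indices.\<close>

lemma polar_mat_square: "polar_mat n * polar_mat n = 1\<^sub>m (2 ^ n)"
proof (rule eq_matI)
  fix i j assume "i < dim_row (1\<^sub>m (2 ^ n) :: bit mat)" "j < dim_col (1\<^sub>m (2 ^ n) :: bit mat)"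
  then have ij: "i < 2 ^ n" "j < 2 ^ n" by auto
  let ?K = "kron_power kernel_mat n" and ?r = "bit_reversal n"
  have c: "?K \<in> carrier_mat (2 ^ n) (2 ^ n)" by (rule kron_power_carrier[OF kernel_mat_carrier])
  have "(polar_mat n * polar_mat n) $$ (i, j) = (\<Sum>k<2 ^ n. polar_mat n $$ (i, k) * polar_mat n $$ (k, j))"
    by (rule index_mult_mat_sum[OF polar_mat_carrier polar_mat_carrier ij])
  also have "\<dots> = (\<Sum>k<2 ^ n. ?K $$ (?r i, k) * ?K $$ (k, ?r j))"
  proof (intro sum.cong refl)
    fix k assume k: "k \<in> {..<2 ^ n :: nat}"
    have "?K $$ (?r k, j) = ?K $$ (k, ?r j)"
      using kernel_power_bit_reversal[of k n "?r j"] k ij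
      by (simp add: bit_reversal_involutive bit_reversal_less)
    then show "polar_mat n $$ (i, k) * polar_mat n $$ (k, j) = ?K $$ (?r i, k) * ?K $$ (k, ?r j)"
      using ij k by (simp add: polar_mat_entry)
  qed
  also have "\<dots> = (?K * ?K) $$ (?r i, ?r j)"
    by (rule index_mult_mat_sum[OF c c, symmetric]) (simp_all add: bit_reversal_less)
  also have "\<dots> = 1\<^sub>m (2 ^ n) $$ (i, j)"
  proof -
    have "?r i = ?r j \<longleftrightarrow> i = j"
      using bit_reversal_involutive[OF ij(1)] bit_reversal_involutive[OF ij(2)] by metis
    then show ?thesis
      unfolding kron_power_square[OF kernel_mat_carrier kernel_mat_square]
      using ij by (simp only: index_one_mat bit_reversal_less)
  qed
  finally show "(polar_mat n * polar_mat n) $$ (i, j) = 1\<^sub>m (2 ^ n) $$ (i, j)" .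
qed (simp_all only: index_mult_mat index_one_mat carrier_matD[OF polar_mat_carrier])

lemma length_polar_transform: "length (polar_transform n w) = 2 ^ n"
  using polar_mat_carrier[of n] by (simp add: polar_transform_def)

lemma polar_transform_involutive:
  assumes "length w = 2 ^ n"
  shows "polar_transform n (polar_transform n w) = w"
proof -
  let ?G = "transpose_mat (polar_mat n)"
  have G: "?G \<in> carrier_mat (2 ^ n) (2 ^ n)"
    using polar_mat_carrier by (simp only: transpose_carrier_mat)
  have w: "vec_of_list w \<in> carrier_vec (2 ^ n)"
    using assms by (metis carrier_vec_dim_vec dim_vec_of_list)
  have GG: "?G * ?G = 1\<^sub>m (2 ^ n)"
    by (simp only: transpose_mult[OF polar_mat_carrier polar_mat_carrier, symmetric]
        polar_mat_square transpose_one)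
  have "polar_transform n (polar_transform n w) = list_of_vec (?G *\<^sub>v (?G *\<^sub>v vec_of_list w))"
    by (simp only: polar_transform_def vec_list)
  also have "?G *\<^sub>v (?G *\<^sub>v vec_of_list w) = vec_of_list w"
    by (simp only: assoc_mult_mat_vec[OF G G w, symmetric] GG one_mult_mat_vec[OF w])
  finally show ?thesis by (simp only: list_vec)
qed

section \<open>Expectations and distance of probability mass functions\<close>

lemma integrable_pmf_bounded:
  fixes f :: "'a \<Rightarrow> real"
  assumes "\<And>x. \<bar>f x\<bar> \<le> c"
  shows "integrable (measure_pmf p) f"
  by (rule measure_pmf.integrable_const_bound[where B = c]) (auto simp: assms)

lemma abs_expectation_pmf_le:
  fixes f :: "'a \<Rightarrow> real"
  assumes "\<And>x. \<bar>f x\<bar> \<le> c"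
  shows "\<bar>measure_pmf.expectation p f\<bar> \<le> c"
proof -
  have "measure_pmf.expectation p f \<le> c"
    by (rule measure_pmf.integral_le_const[OF integrable_pmf_bounded[OF assms]])
      (use assms in \<open>auto simp: abs_le_iff\<close>)
  moreover have "- c \<le> measure_pmf.expectation p f"
    by (rule measure_pmf.integral_ge_const[OF integrable_pmf_bounded[OF assms]])
      (use assms in \<open>auto simp: abs_le_iff minus_le_iff\<close>)
  ultimately show ?thesis by linarith
qed

lemma expectation_bind_pmf:
  fixes f :: "'a \<Rightarrow> real"
  assumes "\<And>x. \<bar>f x\<bar> \<le> c"
  shows "measure_pmf.expectation (bind_pmf p g) f =
    measure_pmf.expectation p (\<lambda>x. measure_pmf.expectation (g x) f)"
  unfolding measure_pmf_bind
  by (rule integral_bind[where K = "count_space UNIV" and B = c and B' = 1])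
    (use assms measurable_measure_pmf[of g] in
      \<open>auto simp: measure_pmf.emeasure_space_1 measure_pmf.finite_measure_axioms\<close>)

lemma abs_summable_pmf_mult:
  fixes f :: "'a \<Rightarrow> real"
  assumes "\<And>x. \<bar>f x\<bar> \<le> c"
  shows "Infinite_Set_Sum.abs_summable_on (\<lambda>x. pmf p x * f x) A"
proof (rule abs_summable_on_comparison_test)
  show "Infinite_Set_Sum.abs_summable_on (\<lambda>x. c * pmf p x) A"
    by (intro abs_summable_on_cmult_right pmf_abs_summable)
  fix x
  have "0 \<le> c" using assms[of x] by linarith
  then show "norm (pmf p x * f x) \<le> norm (c * pmf p x)"
    using assms[of x] by (simp add: abs_mult mult.commute mult_right_mono)
qed

lemma summable_pmf_mult:
  fixes f :: "'a \<Rightarrow> real"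
  assumes "\<And>x. \<bar>f x\<bar> \<le> c"
  shows "(\<lambda>x. pmf p x * f x) summable_on A"
  using abs_summable_pmf_mult[of f c p A] assms
  by (metis abs_summable_equivalent abs_summable_summable)

lemma expectation_pmf_infsum:
  fixes f :: "'a \<Rightarrow> real"
  assumes "\<And>x. \<bar>f x\<bar> \<le> c"
  shows "measure_pmf.expectation p f = (\<Sum>\<^sub>\<infinity>x. pmf p x * f x)"
  unfolding pmf_expectation_eq_infsetsum
  by (rule infsetsum_infsum[OF abs_summable_pmf_mult[OF assms]])

lemma summable_pmf: "pmf p summable_on A"
  using summable_pmf_mult[of "\<lambda>_. 1" 1 p A] by simp

lemma summable_abs_diff_pmf: "(\<lambda>z. \<bar>pmf p z - pmf q z\<bar>) summable_on A"
proof -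
  have "(\<lambda>z. pmf p z + pmf q z) summable_on A"
    by (intro summable_on_add summable_pmf)
  then show ?thesis
    by (rule summable_on_comparison_test) (auto simp: abs_le_iff add_nonneg_nonneg algebra_simps)
qed

section \<open>The l1 distance through bounded test functions\<close>

lemma expectation_diff_infsum:
  fixes h :: "'a \<Rightarrow> real"
  assumes "\<And>x. \<bar>h x\<bar> \<le> c"
  shows "measure_pmf.expectation p h - measure_pmf.expectation q h =
    (\<Sum>\<^sub>\<infinity>x. (pmf p x - pmf q x) * h x)"
  using infsum_add[OF summable_pmf_mult[of h c p UNIV] summable_pmf_mult[of "\<lambda>x. - h x" c q UNIV]] assms
  by (simp add: expectation_pmf_infsum[OF assms] infsum_uminus left_diff_distrib)

text \<open>One half of the dual description of the \<open>l1\<close> distance as a supremum over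
  tests bounded by 1; \<open>l1_dist_le_test\<close> is the other half. From there on, distances are
  handled by expectations instead of infinite sums.\<close>

lemma l1_dist_test:
  fixes h :: "'a \<Rightarrow> real"
  assumes "\<And>x. \<bar>h x\<bar> \<le> 1"
  shows "\<bar>measure_pmf.expectation p h - measure_pmf.expectation q h\<bar> \<le> l1_dist p q"
proof -
  have le: "measure_pmf.expectation p g - measure_pmf.expectation q g \<le> l1_dist p q"
    if g: "\<And>x. \<bar>g x\<bar> \<le> 1" for g :: "'a \<Rightarrow> real"
    unfolding expectation_diff_infsum[OF g] l1_dist_def
  proof (rule infsum_mono)
    show "(\<lambda>x. (pmf p x - pmf q x) * g x) summable_on UNIV"
      using summable_on_add[OF summable_pmf_mult[of g 1 p UNIV] summable_pmf_mult[of "\<lambda>x. - g x" 1 q UNIV]] g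
      by (simp add: left_diff_distrib)
    show "(\<lambda>z. \<bar>pmf p z - pmf q z\<bar>) summable_on UNIV"
      by (rule summable_abs_diff_pmf)
    fix x
    have "(pmf p x - pmf q x) * g x \<le> \<bar>pmf p x - pmf q x\<bar> * \<bar>g x\<bar>"
      by (metis abs_ge_self abs_mult)
    also have "\<dots> \<le> \<bar>pmf p x - pmf q x\<bar>"
      by (rule mult_left_le[OF g]) simp
    finally show "(pmf p x - pmf q x) * g x \<le> \<bar>pmf p x - pmf q x\<bar>" .
  qed
  show ?thesis
    using le[of h] le[of "\<lambda>x. - h x"] assms by (simp add: abs_le_iff)
qed

text \<open>The optimal test function is the sign of the difference of the two densities.\<close>

lemma l1_dist_le_test:
  assumes "\<And>h. (\<And>x. \<bar>h x\<bar> \<le> 1) \<Longrightarrow> measure_pmf.expectation p h - measure_pmf.expectation q h \<le> c"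
  shows "l1_dist p q \<le> c"
proof -
  let ?s = "\<lambda>x. sgn (pmf p x - pmf q x)"
  have s: "\<bar>?s x\<bar> \<le> 1" for x by (simp add: sgn_if)
  have "l1_dist p q = (\<Sum>\<^sub>\<infinity>x. (pmf p x - pmf q x) * ?s x)"
    unfolding l1_dist_def by (simp add: mult_sgn_abs abs_sgn)
  also have "\<dots> = measure_pmf.expectation p ?s - measure_pmf.expectation q ?s"
    by (rule expectation_diff_infsum[symmetric, OF s])
  finally show ?thesis using assms[OF s] by simp
qed

lemma l1_dist_nonneg: "0 \<le> l1_dist p q"
  unfolding l1_dist_def by (rule infsum_nonneg) simp

lemma l1_dist_le_2: "l1_dist p q \<le> 2"
proof (rule l1_dist_le_test)
  fix h :: "'a \<Rightarrow> real" assume "\<And>x. \<bar>h x\<bar> \<le> 1"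
  from abs_expectation_pmf_le[of h 1 p, OF this] abs_expectation_pmf_le[of h 1 q, OF this]
  show "measure_pmf.expectation p h - measure_pmf.expectation q h \<le> 2" by linarith
qed

lemma abs_l1_dist_le_2: "\<bar>l1_dist p q\<bar> \<le> 2"
  using l1_dist_nonneg[of p q] l1_dist_le_2[of p q] by simp

lemma l1_dist_self [simp]: "l1_dist p p = 0"
  by (simp add: l1_dist_def)

text \<open>The intermediate law is \<open>bind_pmf q f\<close>. Passing from \<open>p\<close> to
  \<open>q\<close> is free of further loss because the conditional expectation of a test is again a
  test; passing from \<open>f\<close> to \<open>g\<close> costs the average under \<open>q\<close>.
  In the applications \<open>q\<close> is the ideal law, for which averages of step errors are
  known.\<close>

lemma l1_dist_bind:
  fixes f :: "'a \<Rightarrow> 'b pmf"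
  shows "l1_dist (bind_pmf p f) (bind_pmf q g) \<le>
    l1_dist p q + measure_pmf.expectation q (\<lambda>x. l1_dist (f x) (g x))"
proof (rule l1_dist_le_test)
  fix h :: "'b \<Rightarrow> real" assume h: "\<And>x. \<bar>h x\<bar> \<le> 1"
  let ?F = "\<lambda>x. measure_pmf.expectation (f x) h" and ?G = "\<lambda>x. measure_pmf.expectation (g x) h"
  have FG: "\<bar>?F x\<bar> \<le> 1" "\<bar>?G x\<bar> \<le> 1" for x by (rule abs_expectation_pmf_le[OF h])+
  note int = FG[THEN integrable_pmf_bounded]
  have "measure_pmf.expectation q ?F - measure_pmf.expectation q ?G =
      measure_pmf.expectation q (\<lambda>x. ?F x - ?G x)"
    by (rule Bochner_Integration.integral_diff[symmetric]; rule int)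
  also have "\<dots> \<le> measure_pmf.expectation q (\<lambda>x. l1_dist (f x) (g x))"
  proof (rule integral_mono)
    show "?F x - ?G x \<le> l1_dist (f x) (g x)" for x
      using l1_dist_test[of h "f x" "g x", OF h] by linarith
  qed (intro Bochner_Integration.integrable_diff int integrable_pmf_bounded[OF abs_l1_dist_le_2])+
  finally have "measure_pmf.expectation q ?F - measure_pmf.expectation q ?G
      \<le> measure_pmf.expectation q (\<lambda>x. l1_dist (f x) (g x))" .
  moreover have "measure_pmf.expectation p ?F - measure_pmf.expectation q ?F \<le> l1_dist p q"
    using l1_dist_test[of ?F p q, OF FG(1)] by linarith
  ultimately show "measure_pmf.expectation (bind_pmf p f) h - measure_pmf.expectation (bind_pmf q g) h
      \<le> l1_dist p q + measure_pmf.expectation q (\<lambda>x. l1_dist (f x) (g x))"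
    by (simp add: expectation_bind_pmf[OF h])
qed

lemma l1_dist_map: "l1_dist (map_pmf f p) (map_pmf f q) \<le> l1_dist p q"
  using l1_dist_bind[of p "\<lambda>x. return_pmf (f x)" q "\<lambda>x. return_pmf (f x)"]
  by (simp add: map_pmf_def)

text \<open>The coupling inequality; the factor 2 is the largest difference of two values of a test
  with range [-1,1].\<close>

lemma l1_dist_map_le_disagreement:
  fixes f :: "'a \<Rightarrow> 'b"
  shows "l1_dist (map_pmf f p) (map_pmf g p) \<le> 2 * measure_pmf.prob p {x. f x \<noteq> g x}"
proof (rule l1_dist_le_test)
  fix h :: "'b \<Rightarrow> real" assume h: "\<And>x. \<bar>h x\<bar> \<le> 1"
  have int: "integrable (measure_pmf p) (\<lambda>x. h (f x))" "integrable (measure_pmf p) (\<lambda>x. h (g x))"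
    by (rule integrable_pmf_bounded, rule h)+
  have "measure_pmf.expectation (map_pmf f p) h - measure_pmf.expectation (map_pmf g p) h =
      measure_pmf.expectation p (\<lambda>x. h (f x) - h (g x))"
    by (simp add: Bochner_Integration.integral_diff[OF int])
  also have "\<dots> \<le> measure_pmf.expectation p (\<lambda>x. 2 * indicat_real {x. f x \<noteq> g x} x)"
  proof (rule integral_mono)
    show "h (f x) - h (g x) \<le> 2 * indicat_real {x. f x \<noteq> g x} x" for x
      using h[of "f x"] h[of "g x"] by (auto simp: indicator_def abs_le_iff)
    show "integrable (measure_pmf p) (\<lambda>x. 2 * indicat_real {x. f x \<noteq> g x} x)"
      by (rule integrable_pmf_bounded[where c = 2]) (auto simp: indicator_def)
  qed (intro Bochner_Integration.integrable_diff int)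
  also have "\<dots> = 2 * measure_pmf.prob p {x. f x \<noteq> g x}"
    by simp
  finally show "measure_pmf.expectation (map_pmf f p) h - measure_pmf.expectation (map_pmf g p) h
      \<le> 2 * measure_pmf.prob p {x. f x \<noteq> g x}" .
qed

lemma l1_dist_triangle: "l1_dist p r \<le> l1_dist p q + l1_dist q r"
proof (rule l1_dist_le_test)
  fix h :: "'a \<Rightarrow> real" assume h: "\<And>x. \<bar>h x\<bar> \<le> 1"
  show "measure_pmf.expectation p h - measure_pmf.expectation r h \<le> l1_dist p q + l1_dist q r"
    using l1_dist_test[of h p q, OF h] l1_dist_test[of h q r, OF h] by linarith
qed

lemma expectation_pmf_cong:
  fixes f :: "'a \<Rightarrow> real"
  assumes "\<And>x. x \<in> set_pmf p \<Longrightarrow> f x = g x"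
  shows "measure_pmf.expectation p f = measure_pmf.expectation p g"
  by (rule integral_cong_AE) (use assms in \<open>auto simp: AE_measure_pmf_iff\<close>)

section \<open>Sequential sampling\<close>

lemma pmf_bind_Pair:
  "pmf (bind_pmf p (\<lambda>x. map_pmf (Pair x) (f x))) (x, y) = pmf p x * pmf (f x) y"
proof -
  have "pmf (map_pmf (Pair x') (f x')) (x, y) = pmf (f x) y * indicat_real {x} x'" for x'
  proof (cases "x' = x")
    case True
    then show ?thesis by (simp add: pmf_map_inj' inj_on_def)
  next
    case False
    then have "(x, y) \<notin> Pair x' ` set_pmf (f x')" by auto
    with False show ?thesis by (simp add: pmf_map_outside)
  qed
  then have "pmf (bind_pmf p (\<lambda>x. map_pmf (Pair x) (f x))) (x, y) =
      measure_pmf.expectation p (\<lambda>x'. pmf (f x) y * indicat_real {x} x')"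
    by (simp only: pmf_bind)
  also have "\<dots> = pmf (f x) y * pmf p x"
    by (simp add: measure_pmf_single)
  finally show ?thesis by simp
qed

text \<open>Uniqueness of disintegration: a joint law determines its conditional laws at all points
  of positive mass. It identifies the ideal sampler with the true conditional law of the polarized
  sequence.\<close>

lemma bind_Pair_cancel:
  assumes "bind_pmf p (\<lambda>x. map_pmf (Pair x) (f x)) = bind_pmf p (\<lambda>x. map_pmf (Pair x) (g x))"
    and "x \<in> set_pmf p"
  shows "f x = g x"
proof (rule pmf_eqI)
  fix y
  have "pmf p x * pmf (f x) y = pmf p x * pmf (g x) y"
    using arg_cong[OF assms(1), of "\<lambda>M. pmf M (x, y)"] by (simp only: pmf_bind_Pair)
  then show "pmf (f x) y = pmf (g x) y"
    using assms(2) by (simp add: set_pmf_iff)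
qed

lemma sequential_pmf_Suc_map:
  "sequential_pmf K (Suc m) = bind_pmf (sequential_pmf K m) (\<lambda>v. map_pmf (\<lambda>b. v @ [b]) (K m v))"
  by (simp add: map_pmf_def)

lemma length_sequential_pmf: "v \<in> set_pmf (sequential_pmf K m) \<Longrightarrow> length v = m"
  by (induction m arbitrary: v) auto

text \<open>Telescoping by \<open>l1_dist_bind\<close>, with the error of step \<open>i\<close>
  averaged over prefixes drawn from \<open>K\<close>, not from \<open>A\<close>. Appending the new
  entry to its prefix is a map and so does not increase the distance.\<close>

lemma l1_dist_sequential:
  "l1_dist (sequential_pmf A m) (sequential_pmf K m) \<le>
    (\<Sum>i<m. measure_pmf.expectation (sequential_pmf K i) (\<lambda>v. l1_dist (A i v) (K i v)))"
proof (induction m)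
  case 0
  then show ?case by simp
next
  case (Suc m)
  have "l1_dist (sequential_pmf A (Suc m)) (sequential_pmf K (Suc m)) \<le>
      l1_dist (sequential_pmf A m) (sequential_pmf K m) + measure_pmf.expectation (sequential_pmf K m)
        (\<lambda>v. l1_dist (map_pmf (\<lambda>b. v @ [b]) (A m v)) (map_pmf (\<lambda>b. v @ [b]) (K m v)))"
    unfolding sequential_pmf_Suc_map by (rule l1_dist_bind)
  also have "measure_pmf.expectation (sequential_pmf K m)
        (\<lambda>v. l1_dist (map_pmf (\<lambda>b. v @ [b]) (A m v)) (map_pmf (\<lambda>b. v @ [b]) (K m v)))
      \<le> measure_pmf.expectation (sequential_pmf K m) (\<lambda>v. l1_dist (A m v) (K m v))"
    by (intro integral_mono l1_dist_map integrable_pmf_bounded[OF abs_l1_dist_le_2])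
  finally show ?case using Suc.IH unfolding sum.lessThan_Suc by linarith
qed

lemma pmf_sequential:
  assumes "length v = m"
  shows "pmf (sequential_pmf K m) v = (\<Prod>i<m. pmf (K i (take i v)) (v ! i))"
  using assms
proof (induction m arbitrary: v)
  case 0
  then show ?case by simp
next
  case (Suc m)
  then obtain w b where v: "v = w @ [b]" and w: "length w = m"
    by (cases v rule: rev_cases) auto
  have inj: "inj (\<lambda>(v :: 'a list, b). v @ [b])" by (auto simp: inj_on_def)
  have "sequential_pmf K (Suc m) =
      map_pmf (\<lambda>(v, b). v @ [b]) (bind_pmf (sequential_pmf K m) (\<lambda>v. map_pmf (Pair v) (K m v)))"
    by (simp only: sequential_pmf_Suc_map map_bind_pmf pmf.map_comp comp_def case_prod_conv)
  moreover have "v = (\<lambda>(v, b). v @ [b]) (w, b)" by (simp add: v)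
  ultimately have "pmf (sequential_pmf K (Suc m)) v =
      pmf (bind_pmf (sequential_pmf K m) (\<lambda>v. map_pmf (Pair v) (K m v))) (w, b)"
    by (simp only: pmf_map_inj'[OF inj])
  also have "\<dots> = (\<Prod>i<m. pmf (K i (take i w)) (w ! i)) * pmf (K m w) b"
    by (simp only: pmf_bind_Pair Suc.IH[OF w])
  also have "(\<Prod>i<m. pmf (K i (take i w)) (w ! i)) = (\<Prod>i<m. pmf (K i (take i v)) (v ! i))"
    by (intro prod.cong refl) (simp add: v w nth_append)
  also have "pmf (K m w) b = pmf (K m (take m v)) (v ! m)"
    by (simp add: v w nth_append)
  finally show ?case by (simp only: prod.lessThan_Suc)
qed

section \<open>Independent copies, memoryless channels, randomness drawn in advance\<close>

lemma replicate_pmf_Suc_snoc: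
  "replicate_pmf (Suc m) p = bind_pmf (replicate_pmf m p) (\<lambda>xs. map_pmf (\<lambda>x. xs @ [x]) p)"
  using replicate_pmf_distrib[of m 1 p]
  by (simp add: map_pmf_def bind_return_pmf bind_assoc_pmf)

lemma sequential_pmf_cong:
  assumes "\<And>i v. i < m \<Longrightarrow> length v = i \<Longrightarrow> K i v = L i v"
  shows "sequential_pmf K m = sequential_pmf L m"
  using assms
proof (induction m)
  case (Suc m)
  then show ?case
    unfolding sequential_pmf_Suc_map
    by (intro bind_pmf_cong map_pmf_cong refl) (auto dest: length_sequential_pmf)
qed simp

text \<open>The memoryless channel with transition law \<open>W\<close>.\<close>

primrec kernel_product :: "('a \<Rightarrow> 'b pmf) \<Rightarrow> 'a list \<Rightarrow> 'b list pmf" where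
  "kernel_product W [] = return_pmf []"
| "kernel_product W (z # zs) =
     do {u \<leftarrow> W z; us \<leftarrow> kernel_product W zs; return_pmf (u # us)}"

lemma replicate_pmf_bind_kernel:
  "bind_pmf (replicate_pmf m p) (\<lambda>zs. map_pmf (Pair zs) (kernel_product W zs)) =
   map_pmf (\<lambda>w. (map fst w, map snd w)) (replicate_pmf m (bind_pmf p (\<lambda>z. map_pmf (Pair z) (W z))))"
proof (induction m)
  case 0
  then show ?case by (simp add: bind_return_pmf)
next
  case (Suc m)
  let ?Q = "bind_pmf p (\<lambda>z. map_pmf (Pair z) (W z))"
  have "map_pmf (\<lambda>w. (map fst w, map snd w)) (replicate_pmf (Suc m) ?Q) =
      bind_pmf p (\<lambda>z. bind_pmf (W z) (\<lambda>u.
        bind_pmf (map_pmf (\<lambda>w. (map fst w, map snd w)) (replicate_pmf m ?Q))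
          (\<lambda>(zs, us). return_pmf (z # zs, u # us))))"
    by (simp add: map_bind_pmf bind_assoc_pmf bind_map_pmf)
  also have "\<dots> = bind_pmf p (\<lambda>z. bind_pmf (W z) (\<lambda>u. bind_pmf (replicate_pmf m p) (\<lambda>zs.
        bind_pmf (kernel_product W zs) (\<lambda>us. return_pmf (z # zs, u # us)))))"
    by (simp only: Suc.IH[symmetric] bind_assoc_pmf bind_map_pmf case_prod_conv)
  also have "\<dots> = bind_pmf p (\<lambda>z. bind_pmf (replicate_pmf m p) (\<lambda>zs. bind_pmf (W z) (\<lambda>u.
        bind_pmf (kernel_product W zs) (\<lambda>us. return_pmf (z # zs, u # us)))))"
    by (intro bind_pmf_cong refl bind_commute_pmf)
  also have "\<dots> = bind_pmf (replicate_pmf (Suc m) p) (\<lambda>zs. map_pmf (Pair zs) (kernel_product W zs))"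
    by (simp add: map_bind_pmf bind_assoc_pmf bind_return_pmf)
  finally show ?case by simp
qed

text \<open>Deferred decisions: step \<open>i\<close> reads only entry \<open>i\<close> of the
  random list, so the entry may be drawn at the moment it is used. This integrates out the shared
  bits from A's sampler.\<close>

lemma bind_replicate_sequential_pmf:
  "bind_pmf (replicate_pmf m p) (\<lambda>zs. sequential_pmf (\<lambda>i v. K i v (zs ! i)) m) =
   sequential_pmf (\<lambda>i v. bind_pmf p (K i v)) m"
proof (induction m)
  case 0
  then show ?case by (simp add: bind_return_pmf)
next
  case (Suc m)
  let ?S = "\<lambda>zs m. sequential_pmf (\<lambda>i v. K i v (zs ! i)) m"
  have seq: "?S (zs @ [z]) (Suc m) = bind_pmf (?S zs m) (\<lambda>v. map_pmf (\<lambda>b. v @ [b]) (K m v z))"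
    if "zs \<in> set_pmf (replicate_pmf m p)" for zs z
  proof -
    have len: "length zs = m" using that by (simp add: set_replicate_pmf)
    then have "?S (zs @ [z]) m = ?S zs m"
      by (intro sequential_pmf_cong) (simp add: nth_append)
    moreover have "(zs @ [z]) ! m = z" using len by (metis nth_append_length)
    ultimately show ?thesis by (simp only: sequential_pmf_Suc_map)
  qed
  have "bind_pmf (replicate_pmf (Suc m) p) (\<lambda>zs. ?S zs (Suc m)) =
      bind_pmf (replicate_pmf m p) (\<lambda>zs. bind_pmf p (\<lambda>z. ?S (zs @ [z]) (Suc m)))"
    by (simp add: replicate_pmf_Suc_snoc bind_assoc_pmf bind_map_pmf del: replicate_pmf.simps sequential_pmf.simps)
  also have "\<dots> = bind_pmf (replicate_pmf m p) (\<lambda>zs. bind_pmf p (\<lambda>z. bind_pmf (?S zs m)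
      (\<lambda>v. map_pmf (\<lambda>b. v @ [b]) (K m v z))))"
    by (intro bind_pmf_cong refl) (simp add: seq del: sequential_pmf.simps)
  also have "\<dots> = bind_pmf (replicate_pmf m p) (\<lambda>zs. bind_pmf (?S zs m) (\<lambda>v. bind_pmf p
      (\<lambda>z. map_pmf (\<lambda>b. v @ [b]) (K m v z))))"
    by (intro bind_pmf_cong refl bind_commute_pmf)
  also have "\<dots> = sequential_pmf (\<lambda>i v. bind_pmf p (K i v)) (Suc m)"
    by (simp add: sequential_pmf_Suc_map Suc.IH[symmetric] bind_assoc_pmf map_bind_pmf del: sequential_pmf.simps)
  finally show ?case .
qed

lemma nth_sequential_pmf:
  assumes "v \<in> set_pmf (sequential_pmf K m)" "i < m"
  shows "v ! i \<in> set_pmf (K i (take i v))"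
proof -
  have "pmf (sequential_pmf K m) v \<noteq> 0" using assms(1) by (simp add: set_pmf_iff)
  then have "(\<Prod>i<m. pmf (K i (take i v)) (v ! i)) \<noteq> 0"
    by (simp only: pmf_sequential[OF length_sequential_pmf[OF assms(1)]] not_False_eq_True)
  then have "pmf (K i (take i v)) (v ! i) \<noteq> 0"
    using assms(2) by (simp add: prod_zero_iff)
  then show ?thesis by (simp add: set_pmf_iff)
qed

text \<open>The Weierstrass product inequality, in the role of a union bound over the
  coordinates.\<close>

lemma one_minus_prod_le:
  fixes g :: "nat \<Rightarrow> real"
  assumes "\<And>i. 0 \<le> g i" "\<And>i. g i \<le> 1"
  shows "1 - (\<Prod>i<m. g i) \<le> (\<Sum>i<m. 1 - g i)"
proof (induction m)
  case (Suc m)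
  have "(\<Prod>i<m. g i) \<le> 1" "0 \<le> (\<Prod>i<m. g i)"
    using assms by (auto intro: prod_le_1 prod_nonneg)
  then have "(1 - (\<Prod>i<m. g i)) * (1 - g m) \<ge> 0"
    using assms by (intro mult_nonneg_nonneg) simp_all
  then show ?case using Suc.IH by (simp add: algebra_simps)
qed simp

lemma map_replicate_pmf:
  "replicate_pmf m (map_pmf f p) = map_pmf (map f) (replicate_pmf m p)"
  by (induction m) (simp_all add: map_bind_pmf bind_map_pmf)

lemma kernel_product_comp: "kernel_product (W \<circ> f) zs = kernel_product W (map f zs)"
  by (induction zs) simp_all

section \<open>Conditional laws and the Bhattacharyya parameter\<close>

lemma bind_cond_pmf: "bind_pmf (map_pmf S M) (\<lambda>s. cond_pmf M {w. S w = s}) = M"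
proof (rule bind_cond_pmf_cancel)
  fix s w assume "S w = s"
  then show "measure (measure_pmf M) {w. S w = s} = measure (measure_pmf (map_pmf S M)) {s. S w = s}"
    by (simp add: vimage_def eq_commute)
qed auto

text \<open>Holds for every default \<open>d\<close>, because \<open>s\<close> is drawn from the law
  of \<open>S\<close> and therefore always has positive probability.\<close>

lemma bind_cond_law:
  "bind_pmf (map_pmf S M) (\<lambda>s. map_pmf (Pair s) (cond_law d M T S s)) = map_pmf (\<lambda>w. (S w, T w)) M"
proof -
  have "map_pmf (\<lambda>w. (S w, T w)) M =
      bind_pmf (map_pmf S M) (\<lambda>s. map_pmf (\<lambda>w. (S w, T w)) (cond_pmf M {w. S w = s}))"
    by (subst (1) bind_cond_pmf[of S M, symmetric]) (simp only: map_bind_pmf)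
  also have "\<dots> = bind_pmf (map_pmf S M) (\<lambda>s. map_pmf (Pair s) (cond_law d M T S s))"
  proof (intro bind_pmf_cong refl)
    fix s assume s: "s \<in> set_pmf (map_pmf S M)"
    then have ne: "set_pmf M \<inter> {w. S w = s} \<noteq> {}" by auto
    have "map_pmf (\<lambda>w. (S w, T w)) (cond_pmf M {w. S w = s}) =
        map_pmf (\<lambda>w. (s, T w)) (cond_pmf M {w. S w = s})"
      by (intro map_pmf_cong refl) (simp add: set_cond_pmf[OF ne])
    then show "map_pmf (\<lambda>w. (S w, T w)) (cond_pmf M {w. S w = s}) =
        map_pmf (Pair s) (cond_law d M T S s)"
      unfolding cond_law_def if_P[OF s] by (simp only: pmf.map_comp comp_def)
  qed
  finally show ?thesis by (rule sym)
qed

text \<open>The chain rule. Once the prefix has the right joint law with \<open>S\<close>, one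
  application of \<open>bind_cond_law\<close> with conditioning variable
  \<open>(take m (V w), S w)\<close> adds the next coordinate exactly.\<close>

lemma sequential_cond_law:
  assumes "\<And>w. w \<in> set_pmf M \<Longrightarrow> m \<le> length (V w)"
  shows "bind_pmf (map_pmf S M) (\<lambda>s. map_pmf (Pair s)
      (sequential_pmf (\<lambda>i v. cond_law (d i) M (\<lambda>w. V w ! i) (\<lambda>w. (take i (V w), S w)) (v, s)) m)) =
    map_pmf (\<lambda>w. (S w, take m (V w))) M"
  using assms
proof (induction m)
  case 0
  then show ?case by (simp add: bind_return_pmf map_pmf_def bind_assoc_pmf)
next
  case (Suc m)
  let ?K = "\<lambda>s i v. cond_law (d i) M (\<lambda>w. V w ! i) (\<lambda>w. (take i (V w), S w)) (v, s)"
  let ?C = "cond_law (d m) M (\<lambda>w. V w ! m) (\<lambda>w. (take m (V w), S w))"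
  have "bind_pmf (map_pmf S M) (\<lambda>s. map_pmf (Pair s) (sequential_pmf (?K s) (Suc m))) =
      bind_pmf (bind_pmf (map_pmf S M) (\<lambda>s. map_pmf (Pair s) (sequential_pmf (?K s) m)))
        (\<lambda>(s, v). map_pmf (\<lambda>b. (s, v @ [b])) (?C (v, s)))"
    by (simp only: sequential_pmf_Suc_map map_bind_pmf pmf.map_comp comp_def bind_assoc_pmf
        bind_map_pmf case_prod_conv)
  also have "\<dots> = bind_pmf (map_pmf (\<lambda>w. (S w, take m (V w))) M)
        (\<lambda>(s, v). map_pmf (\<lambda>b. (s, v @ [b])) (?C (v, s)))"
    using Suc.prems by (subst Suc.IH) (simp_all add: Suc_le_lessD less_imp_le)
  also have "\<dots> = map_pmf (\<lambda>((v, s), b). (s, v @ [b]))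
      (bind_pmf (map_pmf (\<lambda>w. (take m (V w), S w)) M) (\<lambda>x. map_pmf (Pair x) (?C x)))"
    by (simp only: bind_map_pmf map_bind_pmf pmf.map_comp comp_def case_prod_conv)
  also have "\<dots> = map_pmf (\<lambda>w. (S w, take m (V w) @ [V w ! m])) M"
    by (simp only: bind_cond_law pmf.map_comp comp_def case_prod_conv)
  also have "\<dots> = map_pmf (\<lambda>w. (S w, take (Suc m) (V w))) M"
  proof (intro map_pmf_cong refl)
    fix w assume "w \<in> set_pmf M"
    then show "(S w, take m (V w) @ [V w ! m]) = (S w, take (Suc m) (V w))"
      using Suc.prems[of w] by (simp add: take_Suc_conv_app_nth)
  qed
  finally show ?case .
qed

lemma expectation_cond_law:
  fixes f :: "'s \<Rightarrow> 't \<Rightarrow> real"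
  assumes "\<And>s t. \<bar>f s t\<bar> \<le> c"
  shows "measure_pmf.expectation M (\<lambda>w. f (S w) (T w)) =
    measure_pmf.expectation (map_pmf S M) (\<lambda>s. measure_pmf.expectation (cond_law d M T S s) (f s))"
proof -
  let ?f = "\<lambda>(s, t). f s t"
  have f: "\<bar>?f x\<bar> \<le> c" for x using assms by (cases x) simp
  have "measure_pmf.expectation M (\<lambda>w. f (S w) (T w)) =
      measure_pmf.expectation (map_pmf (\<lambda>w. (S w, T w)) M) ?f"
    by (simp only: integral_map_pmf case_prod_conv)
  also have "\<dots> = measure_pmf.expectation (map_pmf S M)
      (\<lambda>s. measure_pmf.expectation (map_pmf (Pair s) (cond_law d M T S s)) ?f)"
    unfolding bind_cond_law[of S M d T, symmetric] by (rule expectation_bind_pmf[OF f])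
  finally show ?thesis by (simp only: integral_map_pmf case_prod_conv)
qed

section \<open>Binary laws and the Bhattacharyya parameter\<close>

lemma UNIV_bit: "(UNIV :: bit set) = {0, 1}"
proof (rule UNIV_eq_I)
  fix x :: bit
  show "x \<in> {0, 1}" by (cases x rule: bit.exhaust) (simp_all only: insert_iff simp_thms)
qed

lemma expectation_bit_pmf:
  fixes g :: "bit \<Rightarrow> real"
  shows "measure_pmf.expectation c g = pmf c 0 * g 0 + pmf c 1 * g 1"
proof -
  have "measure_pmf.expectation c g = (\<Sum>a\<in>{0, 1}. pmf c a *\<^sub>R g a)"
    by (rule integral_measure_pmf)
      (simp_all only: finite_insert finite.emptyI, simp only: UNIV_bit[symmetric] UNIV_I)
  also have "\<dots> = pmf c 0 *\<^sub>R g 0 + pmf c 1 *\<^sub>R g 1"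
    by (subst sum.insert) simp_all
  finally show ?thesis by (simp only: real_scaleR_def)
qed

lemma pmf_bit_1: "pmf c (1 :: bit) = 1 - pmf c 0"
  using expectation_bit_pmf[of c "\<lambda>_. 1"] by simp

lemma l1_dist_bit: "l1_dist c (d :: bit pmf) = 2 * \<bar>pmf c 0 - pmf d 0\<bar>"
proof -
  have "l1_dist c d = \<bar>pmf c 0 - pmf d 0\<bar> + \<bar>pmf c 1 - pmf d 1\<bar>"
    unfolding l1_dist_def UNIV_bit by (subst infsum_finite) simp_all
  then show ?thesis by (simp add: pmf_bit_1 abs_minus_commute)
qed

text \<open>Values off the support have weight zero, so the default can be chosen to match that of
  the sampler under comparison.\<close>

lemma bhattacharyya_expectation:
  "bhattacharyya M T S = measure_pmf.expectation (map_pmf S M)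
    (\<lambda>s. 2 * sqrt (pmf (cond_law d M T S s) 0 * pmf (cond_law d M T S s) 1))"
proof -
  let ?f = "\<lambda>s. 2 * sqrt (pmf (cond_law d M T S s) 0 * pmf (cond_law d M T S s) 1)"
  have f: "\<bar>?f s\<bar> \<le> 2" for s
    by (simp add: pmf_le_1 mult_le_one)
  have "measure_pmf.expectation (map_pmf S M) ?f = (\<Sum>\<^sub>\<infinity>s. pmf (map_pmf S M) s * ?f s)"
    by (rule expectation_pmf_infsum[OF f])
  also have "\<dots> = (\<Sum>\<^sub>\<infinity>s\<in>set_pmf (map_pmf S M). 2 * (pmf (map_pmf S M) s *
            sqrt (pmf (map_pmf T (cond_pmf M {w. S w = s})) 0 *
                  pmf (map_pmf T (cond_pmf M {w. S w = s})) 1)))"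
  proof (rule infsum_cong_neutral)
    show "pmf (map_pmf S M) s * ?f s = 0" if "s \<in> UNIV - set_pmf (map_pmf S M)" for s
      using that by (simp add: set_pmf_iff del: set_map_pmf)
  qed (auto simp: cond_law_def)
  finally show ?thesis
    unfolding bhattacharyya_def by (simp add: infsum_cmult_right')
qed

lemma sqrt_prod_bounds:
  fixes p :: real
  assumes "0 \<le> p" "p \<le> 1"
  shows "p * (1 - p) \<le> sqrt (p * (1 - p))" "sqrt (p * (1 - p)) \<le> 1 / 2"
proof -
  have "0 \<le> (2 * p - 1)\<^sup>2" by simp
  then have q: "p * (1 - p) \<le> 1 / 4" by (simp add: power2_eq_square algebra_simps)
  have nonneg: "0 \<le> p * (1 - p)" using assms by simp
  have "(p * (1 - p))\<^sup>2 \<le> p * (1 - p)"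
    using nonneg q by (simp add: power2_eq_square mult_left_le)
  then show "p * (1 - p) \<le> sqrt (p * (1 - p))" by (rule real_le_rsqrt)
  show "sqrt (p * (1 - p)) \<le> 1 / 2"
    by (rule real_le_lsqrt) (use q in \<open>simp_all add: power2_eq_square\<close>)
qed

text \<open>A fresh sample from the conditional law misses \<open>T\<close> as often as two
  independent bits with masses \<open>p\<close> and \<open>1 - p\<close> differ, that is with
  probability \<open>2 * p * (1 - p)\<close>. This is at most \<open>2 * sqrt (p * (1 - p))\<close>,
  whose average is the Bhattacharyya parameter.\<close>

lemma sampling_error_le:
  "measure_pmf.expectation M (\<lambda>w. 1 - pmf (cond_law d M T S (S w)) (T w)) \<le> bhattacharyya M T S"
proof -
  let ?c = "cond_law d M T S"
  have b: "\<bar>1 - pmf (?c s) t\<bar> \<le> 1" for s t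
    by (simp add: pmf_le_1)
  have "measure_pmf.expectation M (\<lambda>w. 1 - pmf (?c (S w)) (T w)) =
      measure_pmf.expectation (map_pmf S M) (\<lambda>s. measure_pmf.expectation (?c s) (\<lambda>t. 1 - pmf (?c s) t))"
    by (rule expectation_cond_law[OF b])
  also have "\<dots> = measure_pmf.expectation (map_pmf S M) (\<lambda>s. 2 * (pmf (?c s) 0 * pmf (?c s) 1))"
    by (simp only: expectation_bit_pmf) (simp add: pmf_bit_1 algebra_simps)
  also have "\<dots> \<le> measure_pmf.expectation (map_pmf S M) (\<lambda>s. 2 * sqrt (pmf (?c s) 0 * pmf (?c s) 1))"
  proof (rule integral_mono)
    show "integrable (measure_pmf (map_pmf S M)) (\<lambda>s. 2 * (pmf (?c s) 0 * pmf (?c s) 1))"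
      by (rule integrable_pmf_bounded[where c = 2]) (simp add: abs_mult pmf_le_1 mult_le_one)
    show "integrable (measure_pmf (map_pmf S M)) (\<lambda>s. 2 * sqrt (pmf (?c s) 0 * pmf (?c s) 1))"
      by (rule integrable_pmf_bounded[where c = 2]) (simp add: pmf_le_1 mult_le_one)
    show "2 * (pmf (?c s) 0 * pmf (?c s) 1) \<le> 2 * sqrt (pmf (?c s) 0 * pmf (?c s) 1)" for s
      using sqrt_prod_bounds(1)[of "pmf (?c s) 0"] by (simp add: pmf_bit_1 pmf_le_1)
  qed
  also have "\<dots> = bhattacharyya M T S" by (rule bhattacharyya_expectation[symmetric])
  finally show ?thesis .
qed

text \<open>With \<open>z = 2 * sqrt (p * (1 - p))\<close>, the distance of the bit from uniform is
  \<open>\<bar>2 * p - 1\<bar>\<close>, and its square is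
  \<open>1 - z\<^sup>2 \<le> 2 * (1 - z)\<close>; a mean of \<open>z\<close> near 1 thus forces a
  small mean distance. The bound arises as \<open>e / t + t\<close>, whose two terms are balanced by
  \<open>t = sqrt e\<close>.\<close>

lemma uniform_substitution_error_le:
  assumes "0 < e" "1 - e \<le> bhattacharyya M T S"
  shows "measure_pmf.expectation (map_pmf S M)
    (\<lambda>s. l1_dist (pmf_of_set {0, 1}) (cond_law d M T S s)) \<le> 2 * sqrt e"
proof -
  let ?c = "cond_law d M T S" and ?t = "sqrt e"
  let ?z = "\<lambda>s. 2 * sqrt (pmf (?c s) 0 * pmf (?c s) 1)"
  have t: "0 < ?t" "?t * ?t = e" using assms(1) by simp_all
  have z: "0 \<le> ?z s" "?z s \<le> 1" "(2 * pmf (?c s) 0 - 1)\<^sup>2 = 1 - (?z s)\<^sup>2" for s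
  proof -
    let ?p = "pmf (?c s) 0"
    have p: "0 \<le> ?p" "?p \<le> 1" by (simp_all add: pmf_le_1)
    show "0 \<le> ?z s" by simp
    show "?z s \<le> 1" using sqrt_prod_bounds(2)[OF p] by (simp add: pmf_bit_1)
    have "(sqrt (?p * (1 - ?p)))\<^sup>2 = ?p * (1 - ?p)" using p by simp
    then show "(2 * pmf (?c s) 0 - 1)\<^sup>2 = 1 - (?z s)\<^sup>2"
      unfolding pmf_bit_1 power_mult_distrib by (simp add: power2_eq_square algebra_simps)
  qed
  have int: "integrable (measure_pmf (map_pmf S M)) ?z"
    by (rule integrable_pmf_bounded[where c = 1]) (use z in \<open>simp add: abs_le_iff\<close>)
  have "measure_pmf.expectation (map_pmf S M) (\<lambda>s. l1_dist (pmf_of_set {0, 1}) (?c s)) \<le>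
      measure_pmf.expectation (map_pmf S M) (\<lambda>s. (1 / ?t) * (1 - ?z s) + ?t)"
  proof (rule integral_mono)
    show "integrable (measure_pmf (map_pmf S M)) (\<lambda>s. l1_dist (pmf_of_set {0, 1}) (?c s))"
      by (rule integrable_pmf_bounded[OF abs_l1_dist_le_2])
    show "integrable (measure_pmf (map_pmf S M)) (\<lambda>s. (1 / ?t) * (1 - ?z s) + ?t)"
      by (intro Bochner_Integration.integrable_add integrable_mult_right
          Bochner_Integration.integrable_diff int) simp_all
    fix s
    let ?a = "\<bar>2 * pmf (?c s) 0 - 1\<bar>"
    \<comment> \<open>AM-GM \<open>2 a t \<le> a\<^sup>2 + t\<^sup>2\<close> with \<open>t = sqrt e\<close> replaces the concavity of the square root\<close>
    have "l1_dist (pmf_of_set {0, 1}) (?c s) = ?a"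
      by (simp add: l1_dist_bit pmf_of_set abs_if)
    moreover have "?a \<le> (1 / ?t) * (1 - ?z s) + ?t"
    proof -
      have "0 \<le> (?a - ?t)\<^sup>2" by simp
      then have "2 * (?a * ?t) \<le> ?a\<^sup>2 + ?t * ?t"
        by (simp add: power2_eq_square algebra_simps)
      also have "?a\<^sup>2 = (1 - ?z s) * (1 + ?z s)"
        using z(3)[of s] by (simp add: power2_eq_square algebra_simps)
      also have "\<dots> \<le> (1 - ?z s) * 2"
        by (rule mult_left_mono) (use z[of s] in simp_all)
      finally have "?a * ?t \<le> (1 - ?z s) + ?t * ?t"
        using t(1) by (smt (verit) mult_nonneg_nonneg)
      then have "?a \<le> ((1 - ?z s) + ?t * ?t) / ?t"
        using t(1) by (simp only: pos_le_divide_eq)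
      also have "\<dots> = (1 / ?t) * (1 - ?z s) + ?t"
        using t(1) by (simp only: add_divide_distrib nonzero_mult_div_cancel_right) simp
      finally show ?thesis .
    qed
    ultimately show "l1_dist (pmf_of_set {0, 1}) (?c s) \<le> (1 / ?t) * (1 - ?z s) + ?t" by simp
  qed
  also have "\<dots> = (1 / ?t) * (1 - bhattacharyya M T S) + ?t"
    unfolding bhattacharyya_expectation[of M T S d] using int
    by (simp del: integral_mult_right_zero integral_map_pmf
        add: Bochner_Integration.integral_add Bochner_Integration.integral_diff)
  also have "\<dots> \<le> (1 / ?t) * e + ?t"
    using assms(2) t(1) by (intro add_right_mono mult_left_mono) simp_all
  also have "(1 / ?t) * e = ?t"
  proof -
    have "(1 / x) * (x * x) = x" if "0 < x" for x :: real using that by simp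
    from this[OF t(1)] show ?thesis by (simp only: t(2))
  qed
  finally show ?thesis by simp
qed

text \<open>For bits, half the \<open>l1\<close> distance is at most the probability that
  independent samples of the two laws differ. On average, the sample of the finer law may be
  replaced by \<open>T\<close> itself, which turns that probability into the sampling error of the
  coarser law.\<close>

lemma coarse_substitution_error_le:
  assumes "\<And>w. S' w = g (S w)"
  shows "measure_pmf.expectation (map_pmf S M)
    (\<lambda>s. l1_dist (cond_law d' M T S' (g s)) (cond_law d M T S s)) \<le> 2 * bhattacharyya M T S'"
proof -
  let ?c = "cond_law d M T S" and ?c' = "cond_law d' M T S'"
  have b: "\<bar>1 - pmf (?c' (g s)) t\<bar> \<le> 1" for s t
    by (simp add: pmf_le_1)
  have e: "\<bar>measure_pmf.expectation (?c s) (\<lambda>t. 1 - pmf (?c' (g s)) t)\<bar> \<le> 1" for s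
    by (rule abs_expectation_pmf_le[OF b])
  have "measure_pmf.expectation (map_pmf S M) (\<lambda>s. l1_dist (?c' (g s)) (?c s)) \<le>
      measure_pmf.expectation (map_pmf S M)
        (\<lambda>s. 2 * measure_pmf.expectation (?c s) (\<lambda>t. 1 - pmf (?c' (g s)) t))"
  proof (rule integral_mono)
    show "integrable (measure_pmf (map_pmf S M)) (\<lambda>s. l1_dist (?c' (g s)) (?c s))"
      by (rule integrable_pmf_bounded[OF abs_l1_dist_le_2])
    show "integrable (measure_pmf (map_pmf S M))
        (\<lambda>s. 2 * measure_pmf.expectation (?c s) (\<lambda>t. 1 - pmf (?c' (g s)) t))"
      by (rule integrable_mult_right) (rule integrable_pmf_bounded[OF e])
    fix s
    let ?k = "pmf (?c s) 0" and ?q = "pmf (?c' (g s)) 0"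
    have r: "0 \<le> ?k" "?k \<le> 1" "0 \<le> ?q" "?q \<le> 1" by (simp_all add: pmf_le_1)
    have "0 \<le> ?k * (1 - ?q)" "0 \<le> (1 - ?k) * ?q" using r by simp_all
    then have "\<bar>?q - ?k\<bar> \<le> ?k * (1 - ?q) + (1 - ?k) * ?q"
      by (simp add: abs_le_iff algebra_simps)
    then show "l1_dist (?c' (g s)) (?c s) \<le>
        2 * measure_pmf.expectation (?c s) (\<lambda>t. 1 - pmf (?c' (g s)) t)"
      by (simp only: l1_dist_bit expectation_bit_pmf) (simp add: pmf_bit_1)
  qed
  also have "\<dots> = 2 * measure_pmf.expectation M (\<lambda>w. 1 - pmf (?c' (S' w)) (T w))"
    using expectation_cond_law[of "\<lambda>s t. 1 - pmf (?c' (g s)) t" 1 M S T d, OF b]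
    by (simp del: integral_map_pmf add: assms)
  also have "\<dots> \<le> 2 * bhattacharyya M T S'"
    using sampling_error_le[of M d' T S'] by simp
  finally show ?thesis .
qed

text \<open>The Markov property read backwards: \<open>markov_chain\<close> constrains
  \<open>C\<close> given \<open>A\<close> and \<open>B\<close>, while the sampler needs the law of
  \<open>A\<close> given \<open>B\<close> and \<open>C\<close> to depend on \<open>B\<close>
  alone.\<close>

lemma markov_chain_disintegration:
  fixes A :: "'w \<Rightarrow> 'a" and B :: "'w \<Rightarrow> 'b" and C :: "'w \<Rightarrow> 'c"
  assumes "markov_chain P A B C"
  shows "map_pmf (\<lambda>w. ((B w, C w), A w)) P =
    bind_pmf (map_pmf (\<lambda>w. (B w, C w)) P) (\<lambda>z. map_pmf (Pair z) (cond_law d P A B (fst z)))"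
proof (rule pmf_eqI)
  fix x :: "('b \<times> 'c) \<times> 'a"
  obtain b c a where x: "x = ((b, c), a)" by (cases x) auto
  let ?p = "measure_pmf.prob P"
  have AB: "pmf (map_pmf B P) b * pmf (cond_law d P A B b) a = ?p {w. A w = a \<and> B w = b}"
    using pmf_bind_Pair[of "map_pmf B P" "cond_law d P A B" b a]
    unfolding bind_cond_law by (simp add: pmf_map vimage_def conj_commute)
  have B: "pmf (map_pmf B P) b = ?p {w. B w = b}" by (simp add: pmf_map vimage_def)
  have BC: "pmf (map_pmf (\<lambda>w. (B w, C w)) P) (b, c) = ?p {w. C w = c \<and> B w = b}"
    by (simp add: pmf_map vimage_def conj_commute)
  have L: "pmf (map_pmf (\<lambda>w. ((B w, C w), A w)) P) x = ?p {w. C w = c \<and> A w = a \<and> B w = b}"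
    by (simp add: x pmf_map vimage_def conj_ac)
  have R: "pmf (bind_pmf (map_pmf (\<lambda>w. (B w, C w)) P)
      (\<lambda>z. map_pmf (Pair z) (cond_law d P A B (fst z)))) x =
      ?p {w. C w = c \<and> B w = b} * pmf (cond_law d P A B b) a"
    by (simp only: x pmf_bind_Pair BC fst_conv)
  have "?p {w. C w = c \<and> A w = a \<and> B w = b} = ?p {w. C w = c \<and> B w = b} * pmf (cond_law d P A B b) a"
  proof (cases "?p {w. A w = a \<and> B w = b} > 0")
    case True
    have "?p {w. A w = a \<and> B w = b} \<le> ?p {w. B w = b}"
      by (rule measure_pmf.finite_measure_mono) auto
    with True have b0: "?p {w. B w = b} > 0" by linarith
    have "?p {w. C w = c \<and> A w = a \<and> B w = b} / ?p {w. A w = a \<and> B w = b} =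
        ?p {w. C w = c \<and> B w = b} / ?p {w. B w = b}"
      using assms True unfolding markov_chain_def cond_prob_def by simp
    moreover have "pmf (cond_law d P A B b) a = ?p {w. A w = a \<and> B w = b} / ?p {w. B w = b}"
      using AB b0 unfolding B by (simp add: field_simps)
    moreover have "r = s * q" if "r / x = s / y" "q = x / y" "0 < x" for q r s x y :: real
    proof -
      have "r = r / x * x" using that(3) by simp
      also have "\<dots> = s * q" by (simp add: that(1,2))
      finally show ?thesis .
    qed
    ultimately show ?thesis using True by blast
  next
    case False
    then have z: "?p {w. A w = a \<and> B w = b} = 0"
      using measure_nonneg[of P "{w. A w = a \<and> B w = b}"] by linarith
    have "?p {w. C w = c \<and> A w = a \<and> B w = b} \<le> ?p {w. A w = a \<and> B w = b}"
      by (rule measure_pmf.finite_measure_mono) auto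
    with z have l: "?p {w. C w = c \<and> A w = a \<and> B w = b} = 0"
      using measure_nonneg[of P "{w. C w = c \<and> A w = a \<and> B w = b}"] by linarith
    have "?p {w. C w = c \<and> B w = b} \<le> ?p {w. B w = b}"
      by (rule measure_pmf.finite_measure_mono) auto
    moreover have "0 \<le> ?p {w. C w = c \<and> B w = b}" by (rule measure_nonneg)
    \<comment> \<open>Here \<open>AB\<close> says that a product is zero. If the first factor
      vanishes, then so does the event with \<open>C w = c\<close>; in either case the right-hand
      side is zero, which also covers a null \<open>b\<close>, where the conditional law is the
      default.\<close>
    moreover have "?p {w. B w = b} = 0 \<or> pmf (cond_law d P A B b) a = 0"
      using AB unfolding B z by (simp only: mult_eq_0_iff)
    ultimately have "?p {w. C w = c \<and> B w = b} = 0 \<or> pmf (cond_law d P A B b) a = 0"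
      by linarith
    then show ?thesis unfolding l by (simp only: mult_eq_0_iff eq_commute[of 0])
  qed
  then show "pmf (map_pmf (\<lambda>w. ((B w, C w), A w)) P) x =
      pmf (bind_pmf (map_pmf (\<lambda>w. (B w, C w)) P)
        (\<lambda>z. map_pmf (Pair z) (cond_law d P A B (fst z)))) x"
    by (simp only: L R)
qed

section \<open>The ideal sampler\<close>

definition observation_law :: "(bit \<times> 'x \<times> 'y) pmf \<Rightarrow> nat \<Rightarrow> ('x \<times> 'y) list pmf" where
  "observation_law P n = replicate_pmf (2 ^ n) (map_pmf snd P)"

definition source_X :: "'x list \<times> 'y list \<times> bit list \<times> bit list \<Rightarrow> 'x list" where
  "source_X = (\<lambda>(xs, ys, us, vs). xs)"

definition polar_seq :: "'x list \<times> 'y list \<times> bit list \<times> bit list \<Rightarrow> bit list" where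
  "polar_seq = (\<lambda>(xs, ys, us, vs). vs)"

lemma coord_eq: "coord i = (\<lambda>w. polar_seq w ! i)"
  by (auto simp: coord_def polar_seq_def)

lemma past_X_eq: "past_X i = (\<lambda>w. (take i (polar_seq w), source_X w))"
  by (auto simp: past_X_def polar_seq_def source_X_def)

lemma length_polar_seq: "w \<in> set_pmf (polar_law P n) \<Longrightarrow> length (polar_seq w) = 2 ^ n"
  by (auto simp: polar_law_def polar_seq_def length_polar_transform)

text \<open>What matters about \<open>W\<close> is that it reads the \<open>X\<close> part of the
  observations only; it is the memoryless channel from \<open>X\<close> to \<open>U\<close>, and
  coordinatewise use of the Markov property provides it.\<close>

lemma source_law_disintegration:
  assumes "markov_chain P fst (fst \<circ> snd) (snd \<circ> snd)"
  obtains W where "source_law P n = bind_pmf (observation_law P n)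
      (\<lambda>zs. map_pmf (\<lambda>us. (us, map fst zs, map snd zs)) (W (map fst zs)))"
proof -
  define K where "K = cond_law (\<lambda>_. return_pmf 0) P fst (fst \<circ> snd)"
  let ?Q = "bind_pmf (map_pmf snd P) (\<lambda>z. map_pmf (Pair z) ((K \<circ> fst) z))"
  have "map_pmf (\<lambda>w. (snd w, fst w)) P = ?Q"
    using markov_chain_disintegration[OF assms, of "\<lambda>_. return_pmf 0"]
    by (simp add: K_def comp_def)
  then have "map_pmf (\<lambda>(z, u). (u, z)) ?Q = map_pmf (\<lambda>(z, u). (u, z)) (map_pmf (\<lambda>w. (snd w, fst w)) P)"
    by simp
  then have P: "P = map_pmf (\<lambda>(z, u). (u, z)) ?Q"
    by (simp add: pmf.map_comp comp_def)
  have "source_law P n = map_pmf (\<lambda>w. (map snd w, map (fst \<circ> fst) w, map (snd \<circ> fst) w))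
      (replicate_pmf (2 ^ n) ?Q)"
    unfolding source_law_def
    by (subst (1) P) (simp add: map_replicate_pmf pmf.map_comp comp_def case_prod_beta)
  also have "\<dots> = map_pmf (\<lambda>(zs, us). (us, map fst zs, map snd zs))
      (map_pmf (\<lambda>w. (map fst w, map snd w)) (replicate_pmf (2 ^ n) ?Q))"
    by (simp add: pmf.map_comp comp_def)
  also have "\<dots> = bind_pmf (observation_law P n)
      (\<lambda>zs. map_pmf (\<lambda>us. (us, map fst zs, map snd zs)) (kernel_product K (map fst zs)))"
    unfolding replicate_pmf_bind_kernel[symmetric] kernel_product_comp
    by (simp add: map_bind_pmf pmf.map_comp comp_def observation_law_def)
  finally show ?thesis by (rule that)
qed

locale polar_source =
  fixes P :: "(bit \<times> 'x \<times> 'y) pmf" and n :: nat and dX :: "nat \<Rightarrow> nat \<Rightarrow> bit list \<times> 'x list \<Rightarrow> bit pmf"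
  assumes markov: "markov_chain P fst (fst \<circ> snd) (snd \<circ> snd)"
begin

text \<open>It has the same default as A's step, so that the two coincide outside \<open>F_r\<close>
  and \<open>F_d\<close> even at null histories.\<close>

definition ideal_step :: "'x list \<Rightarrow> nat \<Rightarrow> bit list \<Rightarrow> bit pmf" where
  "ideal_step xs i v = cond_law (dX n i) (polar_law P n) (coord i) (past_X i) (v, xs)"

lemma bind_sequential_ideal_step:
  assumes "m \<le> 2 ^ n"
  shows "bind_pmf (map_pmf source_X (polar_law P n))
      (\<lambda>xs. map_pmf (Pair xs) (sequential_pmf (ideal_step xs) m)) =
    map_pmf (\<lambda>w. (source_X w, take m (polar_seq w))) (polar_law P n)"
  unfolding ideal_step_def[abs_def] coord_eq past_X_eq
  by (rule sequential_cond_law) (simp add: length_polar_seq assms)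

text \<open>The chain rule yields the joint law of the polarized sequence with \<open>X\<close>
  only. The transformed channel \<open>?W\<close> and the sampler thus disintegrate the same joint
  law and agree at every possible \<open>xs\<close>; as the channel ignores \<open>ys\<close>, the
  sampler can replace it in the law that includes \<open>ys\<close>.\<close>

lemma polar_law_sequential:
  "map_pmf (\<lambda>(xs, ys, us, vs). (vs, xs, ys)) (polar_law P n) =
    bind_pmf (observation_law P n) (\<lambda>zs. map_pmf (\<lambda>v. (v, map fst zs, map snd zs))
      (sequential_pmf (ideal_step (map fst zs)) (2 ^ n)))"
  and map_source_X: "map_pmf source_X (polar_law P n) = map_pmf (map fst) (observation_law P n)"
proof -
  obtain W where W: "source_law P n = bind_pmf (observation_law P n)
      (\<lambda>zs. map_pmf (\<lambda>us. (us, map fst zs, map snd zs)) (W (map fst zs)))"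
    using source_law_disintegration[OF markov] by blast
  let ?W = "\<lambda>xs. map_pmf (polar_transform n) (W xs)"
  have M: "polar_law P n = bind_pmf (observation_law P n)
      (\<lambda>zs. map_pmf (\<lambda>us. (map fst zs, map snd zs, us, polar_transform n us)) (W (map fst zs)))"
    unfolding polar_law_def W by (simp add: map_bind_pmf pmf.map_comp comp_def)
  show X: "map_pmf source_X (polar_law P n) = map_pmf (map fst) (observation_law P n)"
    unfolding M by (simp add: map_bind_pmf pmf.map_comp comp_def source_X_def map_pmf_def[of "map fst"])
  have "bind_pmf (map_pmf source_X (polar_law P n)) (\<lambda>xs. map_pmf (Pair xs) (?W xs)) =
      map_pmf (\<lambda>w. (source_X w, polar_seq w)) (polar_law P n)"
    unfolding X unfolding M by (simp add: bind_map_pmf map_bind_pmf pmf.map_comp comp_def source_X_def polar_seq_def)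
  also have "\<dots> = map_pmf (\<lambda>w. (source_X w, take (2 ^ n) (polar_seq w))) (polar_law P n)"
    by (intro map_pmf_cong refl) (simp add: length_polar_seq)
  also have "\<dots> = bind_pmf (map_pmf source_X (polar_law P n))
      (\<lambda>xs. map_pmf (Pair xs) (sequential_pmf (ideal_step xs) (2 ^ n)))"
    by (rule bind_sequential_ideal_step[symmetric]) simp
  finally have eq: "?W xs = sequential_pmf (ideal_step xs) (2 ^ n)"
    if "xs \<in> set_pmf (map_pmf source_X (polar_law P n))" for xs
    by (rule bind_Pair_cancel[OF _ that])
  have "map_pmf (\<lambda>(xs, ys, us, vs). (vs, xs, ys)) (polar_law P n) =
      bind_pmf (observation_law P n) (\<lambda>zs. map_pmf (\<lambda>v. (v, map fst zs, map snd zs)) (?W (map fst zs)))"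
    unfolding M by (simp add: map_bind_pmf pmf.map_comp comp_def)
  also have "\<dots> = bind_pmf (observation_law P n) (\<lambda>zs. map_pmf (\<lambda>v. (v, map fst zs, map snd zs))
      (sequential_pmf (ideal_step (map fst zs)) (2 ^ n)))"
    by (intro bind_pmf_cong map_pmf_cong refl eq) (simp_all add: X eq)
  finally show "map_pmf (\<lambda>(xs, ys, us, vs). (vs, xs, ys)) (polar_law P n) =
    bind_pmf (observation_law P n) (\<lambda>zs. map_pmf (\<lambda>v. (v, map fst zs, map snd zs))
      (sequential_pmf (ideal_step (map fst zs)) (2 ^ n)))" .
qed

text \<open>Turns an average along a run of the ideal sampler into an average under
  \<open>polar_law\<close>, the law in which the Bhattacharyya parameters are defined.\<close>

lemma expectation_past_X:
  fixes f :: "bit list \<Rightarrow> 'x list \<Rightarrow> real"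
  assumes "i \<le> 2 ^ n" "\<And>v xs. \<bar>f v xs\<bar> \<le> c"
  shows "measure_pmf.expectation (observation_law P n) (\<lambda>zs.
      measure_pmf.expectation (sequential_pmf (ideal_step (map fst zs)) i) (\<lambda>v. f v (map fst zs))) =
    measure_pmf.expectation (map_pmf (past_X i) (polar_law P n)) (\<lambda>(v, xs). f v xs)"
proof -
  let ?f = "\<lambda>(xs, v). f v xs"
  have f: "\<bar>?f x\<bar> \<le> c" for x using assms(2) by (cases x) simp
  have "measure_pmf.expectation (map_pmf (past_X i) (polar_law P n)) (\<lambda>(v, xs). f v xs) =
      measure_pmf.expectation (map_pmf (\<lambda>w. (source_X w, take i (polar_seq w))) (polar_law P n)) ?f"
    by (simp only: integral_map_pmf past_X_eq case_prod_conv)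
  also have "\<dots> = measure_pmf.expectation (map_pmf (map fst) (observation_law P n))
      (\<lambda>xs. measure_pmf.expectation (map_pmf (Pair xs) (sequential_pmf (ideal_step xs) i)) ?f)"
    unfolding bind_sequential_ideal_step[OF assms(1), symmetric] map_source_X
    by (rule expectation_bind_pmf[OF f])
  finally show ?thesis by (simp only: integral_map_pmf case_prod_conv)
qed

lemma l1_dist_sequential_polar_law:
  assumes "\<And>i. i < 2 ^ n \<Longrightarrow>
    measure_pmf.expectation (map_pmf (past_X i) (polar_law P n))
      (\<lambda>(v, xs). l1_dist (A xs i v) (ideal_step xs i v)) \<le> e"
  shows "l1_dist
    (bind_pmf (observation_law P n) (\<lambda>zs. map_pmf (\<lambda>v. (v, map fst zs, map snd zs))
      (sequential_pmf (A (map fst zs)) (2 ^ n))))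
    (map_pmf (\<lambda>(xs, ys, us, vs). (vs, xs, ys)) (polar_law P n)) \<le> 2 ^ n * e"
proof -
  let ?R = "observation_law P n"
  let ?d = "\<lambda>zs i v. l1_dist (A (map fst zs) i v) (ideal_step (map fst zs) i v)"
  let ?D = "\<lambda>zs i. measure_pmf.expectation (sequential_pmf (ideal_step (map fst zs)) i) (?d zs i)"
  let ?g = "\<lambda>zs v. (v, map fst zs, map snd zs)"
  have D: "\<bar>?D zs i\<bar> \<le> 2" for zs i
    by (rule abs_expectation_pmf_le[OF abs_l1_dist_le_2])
  have int: "integrable (measure_pmf ?R) (\<lambda>zs. ?D zs i)" for i
    by (rule integrable_pmf_bounded[OF D])
  have "l1_dist
      (bind_pmf ?R (\<lambda>zs. map_pmf (?g zs) (sequential_pmf (A (map fst zs)) (2 ^ n))))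
      (bind_pmf ?R (\<lambda>zs. map_pmf (?g zs) (sequential_pmf (ideal_step (map fst zs)) (2 ^ n)))) \<le>
    l1_dist ?R ?R + measure_pmf.expectation ?R (\<lambda>zs. l1_dist
      (map_pmf (?g zs) (sequential_pmf (A (map fst zs)) (2 ^ n)))
      (map_pmf (?g zs) (sequential_pmf (ideal_step (map fst zs)) (2 ^ n))))"
    by (rule l1_dist_bind)
  also have "\<dots> \<le> measure_pmf.expectation ?R (\<lambda>zs. \<Sum>i<2 ^ n. ?D zs i)"
    unfolding l1_dist_self add_0
  proof (rule integral_mono)
    show "l1_dist (map_pmf (?g zs) (sequential_pmf (A (map fst zs)) (2 ^ n)))
      (map_pmf (?g zs) (sequential_pmf (ideal_step (map fst zs)) (2 ^ n))) \<le> (\<Sum>i<2 ^ n. ?D zs i)" for zs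
      by (rule order.trans[OF l1_dist_map l1_dist_sequential])
  qed (intro Bochner_Integration.integrable_sum int integrable_pmf_bounded[OF abs_l1_dist_le_2])+
  also have "\<dots> = (\<Sum>i<2 ^ n. measure_pmf.expectation ?R (\<lambda>zs. ?D zs i))"
    by (rule Bochner_Integration.integral_sum) (rule int)
  also have "\<dots> \<le> (\<Sum>i<2 ^ n::nat. e)"
  proof (rule sum_mono)
    fix i :: nat assume i: "i \<in> {..<2 ^ n}"
    show "measure_pmf.expectation ?R (\<lambda>zs. ?D zs i) \<le> e"
      using expectation_past_X[of i "\<lambda>v xs. l1_dist (A xs i v) (ideal_step xs i v)" 2] assms[of i] i
      by (simp only: abs_l1_dist_le_2 lessThan_iff less_imp_le simp_thms)
  qed
  finally show ?thesis by (simp add: polar_law_sequential)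
qed

end

section \<open>The protocol\<close>

locale first_round = polar_source P n dX
  for P :: "(bit \<times> 'x \<times> 'y) pmf" and n :: nat and dX :: "nat \<Rightarrow> nat \<Rightarrow> bit list \<times> 'x list \<Rightarrow> bit pmf" +
  fixes \<beta> :: real and dU :: "nat \<Rightarrow> nat \<Rightarrow> bit list \<Rightarrow> bit pmf"
    and dY :: "nat \<Rightarrow> nat \<Rightarrow> bit list \<times> 'y list \<Rightarrow> bit pmf"
begin

lemma delta_bounds: "0 < delta \<beta> n" "delta \<beta> n \<le> sqrt (delta \<beta> n)"
proof -
  have "2 powr - (real (2 ^ n) powr \<beta>) \<le> 2 powr (0 :: real)"
    by (rule powr_mono) simp_all
  then have "delta \<beta> n \<le> 1" by (simp add: delta_def)
  moreover show "0 < delta \<beta> n" by (simp add: delta_def)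
  ultimately have "(delta \<beta> n)\<^sup>2 \<le> delta \<beta> n"
    by (simp add: power2_eq_square mult_left_le)
  then show "delta \<beta> n \<le> sqrt (delta \<beta> n)" by (rule real_le_rsqrt)
qed

text \<open>A's step after the shared bit has been averaged out.\<close>

definition marginal_step :: "'x list \<Rightarrow> nat \<Rightarrow> bit list \<Rightarrow> bit pmf" where
  "marginal_step xs i v =
     (if i \<in> F_r P \<beta> n then pmf_of_set {0, 1}
      else if i \<in> F_d P \<beta> n then cond_law (dU n i) (polar_law P n) (coord i) (past i) v
      else ideal_step xs i v)"

lemma marginal_step_error:
  assumes "i < 2 ^ n"
  shows "measure_pmf.expectation (map_pmf (past_X i) (polar_law P n))
    (\<lambda>(v, xs). l1_dist (marginal_step xs i v) (ideal_step xs i v)) \<le> 2 * sqrt (delta \<beta> n)"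
proof -
  let ?M = "polar_law P n"
  let ?c = "cond_law (dX n i) ?M (coord i) (past_X i)"
  consider "i \<in> F_r P \<beta> n" | "i \<notin> F_r P \<beta> n" "i \<in> F_d P \<beta> n" | "i \<notin> F_r P \<beta> n" "i \<notin> F_d P \<beta> n"
    by blast
  then show ?thesis
  proof cases
    case 1
    then have "1 - delta \<beta> n \<le> bhattacharyya ?M (coord i) (past_X i)"
      by (simp add: F_r_def high_UX_def)
    from uniform_substitution_error_le[OF delta_bounds(1) this, of "dX n i"] 1
    show ?thesis by (simp only: marginal_step_def ideal_step_def if_True case_prod_unfold prod.collapse)
  next
    case 2
    then have Z: "bhattacharyya ?M (coord i) (past i) \<le> delta \<beta> n"
      by (simp add: F_d_def low_U_def)
    have "measure_pmf.expectation (map_pmf (past_X i) ?M)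
        (\<lambda>s. l1_dist (cond_law (dU n i) ?M (coord i) (past i) (fst s)) (?c s)) \<le>
        2 * bhattacharyya ?M (coord i) (past i)"
      by (rule coarse_substitution_error_le) (auto simp: past_def past_X_def)
    also have "\<dots> \<le> 2 * sqrt (delta \<beta> n)" using Z delta_bounds(2) by linarith
    finally show ?thesis
      using 2 by (simp only: marginal_step_def ideal_step_def if_True if_False case_prod_unfold prod.collapse)
  next
    case 3
    then show ?thesis
      using delta_bounds by (simp add: marginal_step_def case_prod_beta)
  qed
qed

text \<open>The probability that B, having followed \<open>v\<close> up to position
  \<open>i\<close>, also produces \<open>v ! i\<close>. It equals 1 where B receives A's bit or
  reads the same shared bit.\<close>

definition agreement :: "nat \<Rightarrow> bit list \<Rightarrow> 'y list \<Rightarrow> real" where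
  "agreement i v ys =
     (if i \<in> I_sent P \<beta> n \<or> i \<in> F_r P \<beta> n then 1
      else if i \<in> F_d P \<beta> n then pmf (cond_law (dU n i) (polar_law P n) (coord i) (past i) (take i v)) (v ! i)
      else pmf (cond_law (dY n i) (polar_law P n) (coord i) (past_Y i) (take i v, ys)) (v ! i))"

lemma agreement_bounds: "0 \<le> agreement i v ys" "agreement i v ys \<le> 1"
  by (simp_all add: agreement_def pmf_le_1)

lemma expected_disagreement_le:
  assumes "i < 2 ^ n"
  shows "measure_pmf.expectation (polar_law P n) (\<lambda>(xs, ys, us, vs). 1 - agreement i vs ys) \<le> delta \<beta> n"
proof -
  let ?M = "polar_law P n"
  consider "i \<in> I_sent P \<beta> n \<or> i \<in> F_r P \<beta> n"
    | "\<not> (i \<in> I_sent P \<beta> n \<or> i \<in> F_r P \<beta> n)" "i \<in> F_d P \<beta> n"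
    | "\<not> (i \<in> I_sent P \<beta> n \<or> i \<in> F_r P \<beta> n)" "i \<notin> F_d P \<beta> n"
    by blast
  then show ?thesis
  proof cases
    case 1
    then have "agreement i v ys = 1" for v ys
      by (simp add: agreement_def)
    then show ?thesis using delta_bounds(1) by (simp add: case_prod_unfold)
  next
    case 2
    then have eq: "(\<lambda>(xs, ys, us, vs). 1 - agreement i vs ys) =
        (\<lambda>w. 1 - pmf (cond_law (dU n i) ?M (coord i) (past i) (past i w)) (coord i w))"
      by (auto simp: agreement_def past_def coord_def)
    have Z: "bhattacharyya ?M (coord i) (past i) \<le> delta \<beta> n"
      using 2 by (simp add: F_d_def low_U_def)
    show ?thesis
      by (subst eq) (rule order.trans[OF sampling_error_le Z])
  next
    case 3
    then have eq: "(\<lambda>(xs, ys, us, vs). 1 - agreement i vs ys) =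
        (\<lambda>w. 1 - pmf (cond_law (dY n i) ?M (coord i) (past_Y i) (past_Y i w)) (coord i w))"
      by (auto simp: agreement_def past_Y_def coord_def)
    \<comment> \<open>A coordinate in none of the other branches lies in \<open>I_set\<close> but
      not in \<open>I_sent\<close>, and hence in \<open>low_UY\<close>.\<close>
    have Z: "bhattacharyya ?M (coord i) (past_Y i) \<le> delta \<beta> n"
      using 3 assms by (auto simp: I_sent_def I_set_def F_r_def F_d_def low_UY_def)
    show ?thesis
      by (subst eq) (rule order.trans[OF sampling_error_le Z])
  qed
qed

definition joint_law :: "(bit list \<times> bit list \<times> 'x list \<times> 'y list) pmf" where
  "joint_law = do {
     zs \<leftarrow> observation_law P n;
     rs \<leftarrow> replicate_pmf (2 ^ n) (pmf_of_set {0, 1});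
     vA \<leftarrow> sequential_pmf (step_A dU dX P \<beta> n rs (map fst zs)) (2 ^ n);
     map_pmf (\<lambda>vB. (vA, vB, map fst zs, map snd zs))
       (sequential_pmf (step_B dU dY P \<beta> n rs vA (map snd zs)) (2 ^ n))
   }"

lemma protocol_law_eq:
  "protocol_law dU dX dY P \<beta> n =
    map_pmf (\<lambda>(vA, vB, xs, ys). (polar_transform n vA, polar_transform n vB, xs, ys)) joint_law"
  unfolding protocol_law_def joint_law_def observation_law_def Let_def
  by (simp only: map_bind_pmf pmf.map_comp comp_def case_prod_conv map_pmf_def bind_assoc_pmf bind_return_pmf)

lemma joint_law_A:
  "map_pmf (\<lambda>(vA, vB, xs, ys). (vA, xs, ys)) joint_law =
    bind_pmf (observation_law P n) (\<lambda>zs. map_pmf (\<lambda>v. (v, map fst zs, map snd zs))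
      (sequential_pmf (marginal_step (map fst zs)) (2 ^ n)))"
proof -
  have "bind_pmf (replicate_pmf (2 ^ n) (pmf_of_set {0, 1}))
      (\<lambda>rs. sequential_pmf (step_A dU dX P \<beta> n rs xs) (2 ^ n)) =
      sequential_pmf (marginal_step xs) (2 ^ n)" for xs
  proof -
    \<comment> \<open>The shared bit becomes an explicit argument \<open>r\<close>, the shape in
      which \<open>bind_replicate_sequential_pmf\<close> can defer its draw.\<close>
    let ?K = "\<lambda>i v r. if i \<in> F_r P \<beta> n then return_pmf r else marginal_step xs i v"
    have A: "step_A dU dX P \<beta> n rs xs = (\<lambda>i v. ?K i v (rs ! i))" for rs
      by (intro ext) (simp add: step_A_def marginal_step_def ideal_step_def)
    have m: "marginal_step xs = (\<lambda>i v. bind_pmf (pmf_of_set {0, 1}) (?K i v))"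
      by (intro ext) (simp add: marginal_step_def bind_return_pmf')
    show ?thesis
      unfolding A
      by (rule trans[OF bind_replicate_sequential_pmf[of "2 ^ n" "pmf_of_set {0, 1}" ?K]])
        (rule arg_cong[OF m[symmetric], where f = "\<lambda>K. sequential_pmf K _"])
  qed
  note marginal = this
  have "map_pmf (\<lambda>(vA, vB, xs, ys). (vA, xs, ys)) joint_law =
      bind_pmf (observation_law P n) (\<lambda>zs. bind_pmf (replicate_pmf (2 ^ n) (pmf_of_set {0, 1}))
        (\<lambda>rs. bind_pmf (sequential_pmf (step_A dU dX P \<beta> n rs (map fst zs)) (2 ^ n))
          (\<lambda>v. return_pmf (v, map fst zs, map snd zs))))"
    by (simp only: joint_law_def map_bind_pmf pmf.map_comp comp_def case_prod_conv map_pmf_const)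
  also have "\<dots> = bind_pmf (observation_law P n) (\<lambda>zs. map_pmf (\<lambda>v. (v, map fst zs, map snd zs))
      (bind_pmf (replicate_pmf (2 ^ n) (pmf_of_set {0, 1}))
        (\<lambda>rs. sequential_pmf (step_A dU dX P \<beta> n rs (map fst zs)) (2 ^ n))))"
    by (simp only: map_pmf_def bind_assoc_pmf)
  finally show ?thesis by (simp only: marginal)
qed

text \<open>
  B reads A's sequence and the shared bits only where agreement is certain, so the right-hand side
  is a function of A's sequence and \<open>ys\<close> alone.
\<close>

lemma pmf_step_B:
  assumes vA: "vA \<in> set_pmf (sequential_pmf (step_A dU dX P \<beta> n rs xs) (2 ^ n))"
  shows "pmf (sequential_pmf (step_B dU dY P \<beta> n rs vA ys) (2 ^ n)) vA = (\<Prod>i<2 ^ n. agreement i vA ys)"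
proof -
  have "pmf (step_B dU dY P \<beta> n rs vA ys i (take i vA)) (vA ! i) = agreement i vA ys"
    if "i < 2 ^ n" for i
  proof -
    \<comment> \<open>On \<open>F_r\<close> A's step is a point mass, so membership in the support
      pins the bit down.\<close>
    have "vA ! i = rs ! i" if "i \<in> F_r P \<beta> n"
      using nth_sequential_pmf[OF vA \<open>i < 2 ^ n\<close>] that by (simp add: step_A_def)
    then show ?thesis by (simp add: step_B_def agreement_def)
  qed
  then show ?thesis
    unfolding pmf_sequential[OF length_sequential_pmf[OF vA]] by (intro prod.cong) simp_all
qed

text \<open>Given A's output, B repeats it with a probability that no longer involves the shared
  bits. The disagreement is therefore the expectation of a bounded function under the law of A's
  sequence and the observations, and this law can be exchanged for the ideal one.\<close>

lemma disagreement_probability: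
  "measure_pmf.prob joint_law {(vA, vB, xs, ys). vA \<noteq> vB} =
    measure_pmf.expectation (map_pmf (\<lambda>(vA, vB, xs, ys). (vA, xs, ys)) joint_law)
      (\<lambda>(v, xs, ys). 1 - (\<Prod>i<2 ^ n. agreement i v ys))"
proof -
  let ?ind = "indicat_real {(vA, vB, xs :: 'x list, ys :: 'y list). vA \<noteq> vB}"
  let ?f = "\<lambda>(vA, vB :: bit list, xs :: 'x list, ys). 1 - (\<Prod>i<2 ^ n. agreement i vA ys)"
  let ?R = "observation_law P n" and ?U = "replicate_pmf (2 ^ n) (pmf_of_set {0, 1 :: bit})"
  let ?A = "\<lambda>zs rs. sequential_pmf (step_A dU dX P \<beta> n rs (map fst zs)) (2 ^ n)"
  let ?B = "\<lambda>zs rs vA. sequential_pmf (step_B dU dY P \<beta> n rs vA (map snd zs)) (2 ^ n)"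
  have ind: "\<bar>?ind x\<bar> \<le> 1" for x by (simp add: indicator_def)
  have prod: "0 \<le> (\<Prod>i<2 ^ n. agreement i v ys)" "(\<Prod>i<2 ^ n. agreement i v ys) \<le> 1" for v ys
    by (auto intro: prod_nonneg prod_le_1 simp: agreement_bounds)
  have f: "\<bar>?f x\<bar> \<le> 1" for x
    by (cases x) (use prod in \<open>simp add: abs_le_iff add_increasing2\<close>)
  have "measure_pmf.expectation (?B zs rs vA) (\<lambda>vB. ?ind (vA, vB, map fst zs, map snd zs)) =
      1 - (\<Prod>i<2 ^ n. agreement i vA (map snd zs))"
    if "vA \<in> set_pmf (?A zs rs)" for zs rs vA
  proof -
    have "measure_pmf.expectation (?B zs rs vA) (\<lambda>vB. ?ind (vA, vB, map fst zs, map snd zs)) =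
        measure_pmf.expectation (?B zs rs vA) (indicat_real (UNIV - {vA}))"
      by (intro arg_cong[where f = "measure_pmf.expectation _"] ext) (auto simp: indicator_def)
    also have "\<dots> = measure_pmf.prob (?B zs rs vA) (UNIV - {vA})" by simp
    also have "\<dots> = 1 - pmf (?B zs rs vA) vA"
      using measure_pmf.prob_compl[of "{vA}" "?B zs rs vA"] by (simp add: measure_pmf_single)
    finally show ?thesis by (simp only: pmf_step_B[OF that])
  qed
  note disagree = this
  have "measure_pmf.expectation joint_law ?ind = measure_pmf.expectation joint_law ?f"
    unfolding joint_law_def expectation_bind_pmf[OF ind] expectation_bind_pmf[OF f] integral_map_pmf
  \<comment> \<open>The three congruences peel off the observations, the shared bits and A's
    sequence, so that \<open>vA\<close> is known to be a possible output of A, as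
    \<open>pmf_step_B\<close> requires.\<close>
  proof (rule expectation_pmf_cong, rule expectation_pmf_cong, rule expectation_pmf_cong)
    fix zs :: "('x \<times> 'y) list" and rs vA assume "vA \<in> set_pmf (?A zs rs)"
    then show "measure_pmf.expectation (?B zs rs vA) (\<lambda>vB. ?ind (vA, vB, map fst zs, map snd zs)) =
        measure_pmf.expectation (?B zs rs vA) (\<lambda>vB. ?f (vA, vB, map fst zs, map snd zs))"
      by (simp only: disagree case_prod_conv) simp
  qed
  also have "measure_pmf.expectation joint_law ?ind = measure_pmf.prob joint_law {(vA, vB, xs, ys). vA \<noteq> vB}"
    by simp
  finally show ?thesis by (simp only: integral_map_pmf case_prod_unfold fst_conv snd_conv)
qed

lemma l1_dist_joint_law_A:
  "l1_dist (map_pmf (\<lambda>(vA, vB, xs, ys). (vA, xs, ys)) joint_law)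
    (map_pmf (\<lambda>(xs, ys, us, vs). (vs, xs, ys)) (polar_law P n)) \<le> 2 ^ n * (2 * sqrt (delta \<beta> n))"
  unfolding joint_law_A by (rule l1_dist_sequential_polar_law) (rule marginal_step_error)

lemma disagreement_probability_le:
  "measure_pmf.prob joint_law {(vA, vB, xs, ys). vA \<noteq> vB} \<le> 2 ^ n * (3 * sqrt (delta \<beta> n))"
proof -
  let ?A = "map_pmf (\<lambda>(vA, vB, xs, ys). (vA, xs, ys)) joint_law"
  let ?I = "map_pmf (\<lambda>(xs, ys, us, vs). (vs, xs, ys)) (polar_law P n)"
  let ?f = "\<lambda>(v, xs :: 'x list, ys). 1 - (\<Prod>i<2 ^ n. agreement i v ys)"
  have prod: "0 \<le> (\<Prod>i<2 ^ n. agreement i v ys)" "(\<Prod>i<2 ^ n. agreement i v ys) \<le> 1" for v ys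
    by (auto intro: prod_nonneg prod_le_1 simp: agreement_bounds)
  have f: "\<bar>?f x\<bar> \<le> 1" for x
    by (cases x) (use prod in \<open>simp add: abs_le_iff add_increasing2\<close>)
  have g: "\<bar>1 - agreement i v ys\<bar> \<le> 1" for i v ys
    using agreement_bounds[of i v ys] by (simp add: abs_le_iff)
  have int: "integrable (measure_pmf (polar_law P n)) (\<lambda>(xs, ys, us, vs). 1 - agreement i vs ys)" for i
    by (rule integrable_pmf_bounded[where c = 1]) (simp only: case_prod_unfold g)
  have "measure_pmf.expectation ?I ?f = measure_pmf.expectation (polar_law P n)
      (\<lambda>(xs, ys, us, vs). 1 - (\<Prod>i<2 ^ n. agreement i vs ys))"
    by (simp only: integral_map_pmf case_prod_unfold fst_conv snd_conv)
  also have "\<dots> \<le> measure_pmf.expectation (polar_law P n)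
      (\<lambda>w. \<Sum>i<2 ^ n. (\<lambda>(xs, ys, us, vs). 1 - agreement i vs ys) w)"
  proof (rule integral_mono)
    show "integrable (measure_pmf (polar_law P n))
        (\<lambda>(xs, ys, us, vs). 1 - (\<Prod>i<2 ^ n. agreement i vs ys))"
      by (rule integrable_pmf_bounded[where c = 1])
        (use prod in \<open>simp add: case_prod_unfold abs_le_iff add_increasing2\<close>)
    show "(\<lambda>(xs, ys, us, vs). 1 - (\<Prod>i<2 ^ n. agreement i vs ys)) w \<le>
        (\<Sum>i<2 ^ n. (\<lambda>(xs, ys, us, vs). 1 - agreement i vs ys) w)" for w
      using one_minus_prod_le[of "\<lambda>i. agreement i (snd (snd (snd w))) (fst (snd w))" "2 ^ n"]
      by (simp only: case_prod_unfold agreement_bounds simp_thms)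
  qed (intro Bochner_Integration.integrable_sum int)
  also have "\<dots> = (\<Sum>i<2 ^ n. measure_pmf.expectation (polar_law P n)
      (\<lambda>(xs, ys, us, vs). 1 - agreement i vs ys))"
    by (rule Bochner_Integration.integral_sum) (rule int)
  also have "\<dots> \<le> (\<Sum>i<2 ^ n::nat. sqrt (delta \<beta> n))"
  proof (rule sum_mono)
    fix i :: nat assume "i \<in> {..<2 ^ n}"
    then have "i < 2 ^ n" by simp
    from expected_disagreement_le[OF this] delta_bounds(2)
    show "measure_pmf.expectation (polar_law P n) (\<lambda>(xs, ys, us, vs). 1 - agreement i vs ys)
        \<le> sqrt (delta \<beta> n)" by (rule order.trans)
  qed
  finally have "measure_pmf.expectation ?I ?f \<le> 2 ^ n * sqrt (delta \<beta> n)" by simp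
  \<comment> \<open>Returning from the ideal law to A's actual law adds 2 to the factor 1 obtained
    from the union bound, which makes the constant 3.\<close>
  moreover have "\<bar>measure_pmf.expectation ?A ?f - measure_pmf.expectation ?I ?f\<bar> \<le> l1_dist ?A ?I"
    by (rule l1_dist_test[OF f])
  ultimately have "measure_pmf.expectation ?A ?f \<le> 2 ^ n * (3 * sqrt (delta \<beta> n))"
    using l1_dist_joint_law_A by linarith
  then show ?thesis by (simp only: disagreement_probability)
qed

text \<open>Triangle inequality through A's sequence: the coupling inequality contributes 2 * 3 and
  the distance of A's law from the ideal one contributes 2.\<close>

lemma l1_dist_joint_law_B:
  "l1_dist (map_pmf (\<lambda>(vA, vB, xs, ys). (vB, xs, ys)) joint_law)
    (map_pmf (\<lambda>(xs, ys, us, vs). (vs, xs, ys)) (polar_law P n)) \<le> 2 ^ n * (8 * sqrt (delta \<beta> n))"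
proof -
  let ?a = "\<lambda>(vA, vB :: bit list, xs :: 'x list, ys :: 'y list). (vA :: bit list, xs, ys)"
  let ?b = "\<lambda>(vA :: bit list, vB :: bit list, xs :: 'x list, ys :: 'y list). (vB, xs, ys)"
  have "l1_dist (map_pmf ?b joint_law) (map_pmf ?a joint_law) \<le>
      2 * measure_pmf.prob joint_law {w. ?b w \<noteq> ?a w}"
    by (rule l1_dist_map_le_disagreement)
  also have "{w. ?b w \<noteq> ?a w} = {(vA, vB, xs, ys). vA \<noteq> vB}" by auto
  finally show ?thesis
    using disagreement_probability_le l1_dist_joint_law_A
      l1_dist_triangle[of "map_pmf ?b joint_law"
        "map_pmf (\<lambda>(xs, ys, us, vs). (vs, xs, ys)) (polar_law P n)" "map_pmf ?a joint_law"]
    by linarith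
qed

text \<open>The involution enters here. It presents the source as the image of its polarized law
  under the map that the protocol applies last, so \<open>l1_dist_map\<close> transfers the
  bound.\<close>

lemma source_law_eq:
  "source_law P n = map_pmf (\<lambda>(v, xs, ys). (polar_transform n v, xs, ys))
    (map_pmf (\<lambda>(xs, ys, us, vs). (vs, xs, ys)) (polar_law P n))"
proof -
  have "map_pmf (\<lambda>(v, xs, ys). (polar_transform n v, xs, ys))
      (map_pmf (\<lambda>(xs, ys, us, vs). (vs, xs, ys)) (polar_law P n)) =
    map_pmf (\<lambda>(us, xs, ys). (polar_transform n (polar_transform n us), xs, ys)) (source_law P n)"
    by (simp only: polar_law_def pmf.map_comp comp_def case_prod_unfold fst_conv snd_conv)
  also have "\<dots> = map_pmf (\<lambda>w. w) (source_law P n)"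
  proof (rule map_pmf_cong[OF refl])
    fix w assume "w \<in> set_pmf (source_law P n)"
    then have "length (fst w) = 2 ^ n"
      by (auto simp: source_law_def set_replicate_pmf)
    then show "(case w of (us, xs, ys) \<Rightarrow> (polar_transform n (polar_transform n us), xs, ys)) = w"
      by (cases w) (simp add: polar_transform_involutive)
  qed
  finally show ?thesis by (simp only: map_pmf_ident)
qed

lemma l1_dist_protocol_le:
  "l1_dist (map_pmf (\<lambda>(uA, uB, xs, ys). (uB, xs, ys)) (protocol_law dU dX dY P \<beta> n)) (source_law P n)
    \<le> 2 ^ n * (8 * sqrt (delta \<beta> n))"
proof -
  have "map_pmf (\<lambda>(uA, uB, xs, ys). (uB, xs, ys)) (protocol_law dU dX dY P \<beta> n) =
      map_pmf (\<lambda>(v, xs, ys). (polar_transform n v, xs, ys))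
        (map_pmf (\<lambda>(vA, vB, xs, ys). (vB, xs, ys)) joint_law)"
    by (simp only: protocol_law_eq pmf.map_comp comp_def case_prod_unfold fst_conv snd_conv)
  then show ?thesis
    unfolding source_law_eq by (simp only: order.trans[OF l1_dist_map l1_dist_joint_law_B])
qed

lemma protocol_disagreement_le:
  "1 - measure_pmf.prob (protocol_law dU dX dY P \<beta> n) {(uA, uB, xs, ys). uA = uB}
    \<le> 2 ^ n * (3 * sqrt (delta \<beta> n))"
proof -
  let ?E = "{(vA :: bit list, vB, xs :: 'x list, ys :: 'y list). vA \<noteq> vB}"
  let ?g = "\<lambda>(vA, vB, xs :: 'x list, ys :: 'y list). (polar_transform n vA, polar_transform n vB, xs, ys)"
  have "1 - measure_pmf.prob joint_law ?E = measure_pmf.prob joint_law (UNIV - ?E)"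
    using measure_pmf.prob_compl[of ?E joint_law] by simp
  \<comment> \<open>An inclusion suffices: equal polarized sequences have equal transforms.\<close>
  also have "\<dots> \<le> measure_pmf.prob joint_law (?g -` {(uA, uB, xs, ys). uA = uB})"
    by (rule measure_pmf.finite_measure_mono) auto
  also have "\<dots> = measure_pmf.prob (protocol_law dU dX dY P \<beta> n) {(uA, uB, xs, ys). uA = uB}"
    by (simp only: protocol_law_eq measure_map_pmf)
  finally show ?thesis using disagreement_probability_le by linarith
qed

end

section \<open>Asymptotics in the block length\<close>

lemma sqrt_delta: "sqrt (delta \<beta> n) = 2 powr (- (real (2 ^ n) powr \<beta>) / 2)"
  unfolding delta_def by (simp add: powr_half_sqrt[symmetric] powr_powr)

text \<open>Because \<open>a < b\<close>, the gap between the two exponents outgrows both the factor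
  1/2 left by the square root and the logarithm of the block length. The comparison is made for a
  real variable and then composed with \<open>2 ^ n\<close>.\<close>

lemma subexponential_bigo:
  fixes a b :: real
  assumes "0 < a" "a < b"
  shows "(\<lambda>n. 2 ^ n * sqrt (delta b n)) \<in> O(\<lambda>n. 2 powr (- (real (2 ^ n) powr a)))"
proof -
  have "(\<lambda>x::real. x * 2 powr (- (x powr b) / 2)) \<in> O(\<lambda>x. 2 powr (- (x powr a)))"
    using assms by real_asymp
  moreover have "filterlim (\<lambda>n. real (2 ^ n)) at_top sequentially"
    by real_asymp
  ultimately have "(\<lambda>n. real (2 ^ n) * 2 powr (- (real (2 ^ n) powr b) / 2)) \<in> O(\<lambda>n. 2 powr (- (real (2 ^ n) powr a)))"
    by (rule landau_o.big.compose)
  then show ?thesis by (simp add: sqrt_delta)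
qed

theorem lemma5:
  fixes P :: "(bit \<times> 'x::finite \<times> 'y::finite) pmf"
    and \<beta> \<beta>\<^sub>2 :: real
    and dU :: "nat \<Rightarrow> nat \<Rightarrow> bit list \<Rightarrow> bit pmf"
    and dX :: "nat \<Rightarrow> nat \<Rightarrow> bit list \<times> 'x list \<Rightarrow> bit pmf"
    and dY :: "nat \<Rightarrow> nat \<Rightarrow> bit list \<times> 'y list \<Rightarrow> bit pmf"
  assumes "markov_chain P fst (fst \<circ> snd) (snd \<circ> snd)"
    and "0 < \<beta>\<^sub>2" and "\<beta>\<^sub>2 < \<beta>" and "\<beta> < 1 / 2"
  shows "(\<lambda>n. l1_dist (map_pmf (\<lambda>(uA, uB, xs, ys). (uB, xs, ys)) (protocol_law dU dX dY P \<beta> n))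
                 (source_law P n))
           \<in> O(\<lambda>n. 2 powr (- (real (2 ^ n) powr \<beta>\<^sub>2)))
       \<and> (\<lambda>n. 1 - measure_pmf.prob (protocol_law dU dX dY P \<beta> n) {(uA, uB, xs, ys). uA = uB})
           \<in> O(\<lambda>n. 2 powr (- (real (2 ^ n) powr \<beta>\<^sub>2)))"
proof
  \<comment> \<open>The only locale assumption concerns \<open>P\<close>, so the locale predicate
    takes \<open>P\<close> alone and its bounds are available for all \<open>n\<close> at
    once.\<close>
  have round: "first_round P" by unfold_locales (rule assms(1))
  \<comment> \<open>Both claims are instances of this bound; unification sets \<open>c\<close> to 8
    for the distance and to 3 for the disagreement.\<close>
  have bigo: "f \<in> O(\<lambda>n. 2 powr (- (real (2 ^ n) powr \<beta>\<^sub>2)))"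
    if "\<And>n. 0 \<le> f n" "\<And>n. f n \<le> 2 ^ n * (c * sqrt (delta \<beta> n))" for f :: "nat \<Rightarrow> real" and c
  proof -
    have "norm (f n) \<le> c * norm (2 ^ n * sqrt (delta \<beta> n))" for n
      using that[of n] by (simp add: mult_ac delta_def)
    then have "f \<in> O(\<lambda>n. 2 ^ n * sqrt (delta \<beta> n))"
      by (intro bigoI[where c = c] always_eventually allI)
    from landau_o.big_trans[OF this subexponential_bigo[OF assms(2,3)]] show ?thesis .
  qed
  show "(\<lambda>n. l1_dist (map_pmf (\<lambda>(uA, uB, xs, ys). (uB, xs, ys)) (protocol_law dU dX dY P \<beta> n))
                 (source_law P n))
           \<in> O(\<lambda>n. 2 powr (- (real (2 ^ n) powr \<beta>\<^sub>2)))"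
    by (rule bigo[OF l1_dist_nonneg first_round.l1_dist_protocol_le[OF round]])
  show "(\<lambda>n. 1 - measure_pmf.prob (protocol_law dU dX dY P \<beta> n) {(uA, uB, xs, ys). uA = uB})
           \<in> O(\<lambda>n. 2 powr (- (real (2 ^ n) powr \<beta>\<^sub>2)))"
    by (rule bigo[OF _ first_round.protocol_disagreement_le[OF round]]) simp
qed

end
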